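(* Let $G\subset\mathbb{R}^2$ be (the open domain bounded by) a parallelogram with smallest inner angle $\alpha\in(0,\pi/2]$ and side lengths $r$ and $s$. Put \[ A=\frac{\sqrt{r^2+2rs\cos\alpha+s^2}}{\min\{r,s\}\sin\alpha}. \] Then \[ \frac12\left(A+\frac1A\right)\le P(G)\le A . \]
   Context: For four distinct points $a,b,c,d\in\mathbb{R}^2$ set $p(a,b,c,d)=\frac{|a-b||c-d|+|a-d||b-c|}{|a-c||b-d|}$. For a domain $D$ whose boundary is a Jordan curve, the Ptolemy constant is $P(D)=\sup p(a,b,c,d)$ over all distinct $a,b,c,d\in\partial D$ occurring in this order when $\partial D$ is traversed in the positive direction. *)

theory Defs
  imports "HOL-Analysis.Analysis"
begin

definition ptol :: "complex \<Rightarrow> complex \<Rightarrow> complex \<Rightarrow> complex \<Rightarrow> real" where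
  "ptol a b c d = (cmod (a - b) * cmod (c - d) + cmod (a - d) * cmod (b - c)) / (cmod (a - c) * cmod (b - d))"

definition winds_once :: "(real \<Rightarrow> complex) \<Rightarrow> complex \<Rightarrow> bool" where
  "winds_once \<gamma> z \<longleftrightarrow> (\<exists>\<theta>. continuous_on {0..1} \<theta> \<and>
      (\<forall>t\<in>{0..1}. \<gamma> t - z = complex_of_real (cmod (\<gamma> t - z)) * cis (\<theta> t)) \<and>
      \<theta> 1 - \<theta> 0 = 2 * pi)"

definition pos_jordan_param :: "complex set \<Rightarrow> (real \<Rightarrow> complex) \<Rightarrow> bool" where
  "pos_jordan_param D \<gamma> \<longleftrightarrow> simple_path \<gamma> \<and> pathfinish \<gamma> = pathstart \<gamma> \<and>
     path_image \<gamma> = frontier D \<and> (\<forall>z\<in>D. winds_once \<gamma> z)"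

definition ptolemy_const :: "complex set \<Rightarrow> real" where
  "ptolemy_const D = Sup {ptol a b c d | a b c d.
     distinct [a, b, c, d] \<and>
     (\<exists>\<gamma> t1 t2 t3 t4. pos_jordan_param D \<gamma> \<and> 0 \<le> t1 \<and> t1 < t2 \<and> t2 < t3 \<and> t3 < t4 \<and> t4 < 1 \<and>
        \<gamma> t1 = a \<and> \<gamma> t2 = b \<and> \<gamma> t3 = c \<and> \<gamma> t4 = d)}"

definition vec_angle :: "complex \<Rightarrow> complex \<Rightarrow> real" where
  "vec_angle u w = arccos (Re (cnj u * w) / (cmod u * cmod w))"

end

theory Submission
  imports Defs
begin

text \<open>
  For the upper bound put \<open>X = (a - b) (c - d)\<close> and \<open>Y = (a - d) (b - c)\<close>, so that
  \<open>X + Y = (a - c) (b - d)\<close>. The angle between \<open>X\<close> and \<open>- Y\<close> is the sum of two opposite angles of the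
  quadrilateral \<open>abcd\<close>, and if both such sums are at least \<open>2 \<omega>\<close> then \<open>p(a, b, c, d) \<le> 1 / sin \<omega>\<close>.
  Let \<open>\<omega>\<close> be the angle between the long diagonal and the longer side; then \<open>1 / sin \<omega> = A\<close> and
  \<open>2 \<omega> \<le> \<alpha>\<close>. If \<open>b\<close> and \<open>d\<close> lie on equal or adjacent sides, then \<open>a\<close> or \<open>c\<close> has an angle of at least
  \<open>\<alpha>\<close>; if they lie on opposite sides, then \<open>a\<close> and \<open>c\<close> both have an angle of at least \<open>\<omega>\<close>.

  For the lower bound take for \<open>a\<close>, \<open>c\<close> the end points of the long diagonal and for \<open>b\<close>, \<open>d\<close> the feet of
  the perpendiculars from the centre to the longer sides: by the parallelogram law the ratio is
  \<open>(A + 1 / A) / 2\<close>.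
\<close>

section \<open>Order of points on a simple path\<close>

text \<open>The times \<open>t1\<close> and \<open>t3\<close> cut the loop into two closed arcs
  \<open>B\<close> and \<open>C\<close> that meet only in \<open>\<gamma> t1\<close> and
  \<open>\<gamma> t3\<close>. A connected subset with a point in each arc that misses these two
  points would be disconnected by the arcs.\<close>

lemma simple_path_separation:
  fixes \<gamma> :: "real \<Rightarrow> 'a::t2_space"
  assumes \<gamma>: "simple_path \<gamma>"
    and t: "0 \<le> t1" "t1 < t2" "t2 < t3" "t3 < t4" "t4 < 1"
    and S: "connected S" "S \<subseteq> path_image \<gamma>" "\<gamma> t2 \<in> S" "\<gamma> t4 \<in> S"
  shows "\<gamma> t1 \<in> S \<or> \<gamma> t3 \<in> S"
proof (rule ccontr)
  assume neg: "\<not> (\<gamma> t1 \<in> S \<or> \<gamma> t3 \<in> S)"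
  define B where "B = \<gamma> ` {t1..t3}"
  define C where "C = \<gamma> ` ({0..t1} \<union> {t3..1})"
  have cont: "continuous_on {0..1} \<gamma>"
    using \<gamma> by (simp add: simple_path_def path_def)
  have "compact B" "compact C"
    unfolding B_def C_def using t
    by (auto intro!: compact_continuous_image continuous_on_subset[OF cont])
  then have closed: "closed B" "closed C"
    by (auto intro: compact_imp_closed)
  have "S \<subseteq> B \<union> C"
    using S(2) t unfolding B_def C_def path_image_def by (force simp: image_iff)
  moreover have "B \<inter> C \<inter> S = {}"
  proof -
    have "z \<in> {\<gamma> t1, \<gamma> t3}" if "z \<in> B" "z \<in> C" for z
    proof -
      from that(1) obtain x where x: "x \<in> {t1..t3}" "z = \<gamma> x"
        unfolding B_def by (rule imageE) auto
      from that(2) obtain y where y: "y \<in> {0..t1} \<union> {t3..1}" "z = \<gamma> y"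
        unfolding C_def by (rule imageE) auto
      have "x \<in> {0..1}" "y \<in> {0..1}" "\<gamma> x = \<gamma> y"
        using x y t by auto
      then have "x = y \<or> x = 0 \<and> y = 1 \<or> x = 1 \<and> y = 0"
        using \<gamma> unfolding simple_path_def loop_free_def by blast
      \<comment> \<open>The closing point is the only other coincidence: \<open>x = 1\<close> is
        impossible, and \<open>x = 0\<close> forces \<open>t1 = 0\<close>, again a division
        point.\<close>
      moreover have "x < 1" using x(1) t by auto
      moreover have "x = t1" if "x = 0" using x(1) t that by auto
      moreover have "x = t1 \<or> x = t3" if "x = y" using x(1) y(1) that by auto
      ultimately have "x = t1 \<or> x = t3" by auto
      then show ?thesis using x(2) by blast
    qed
    then show ?thesis using neg by blast
  qed
  ultimately have "B \<inter> S = {} \<or> C \<inter> S = {}"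
    using connected_closedD[OF S(1)] closed by blast
  moreover have "\<gamma> t2 \<in> B" "\<gamma> t4 \<in> C"
    using t by (auto simp: B_def C_def)
  ultimately show False using S(3,4) by blast
qed

section \<open>Angles in a parallelogram\<close>

text \<open>When \<open>P\<close>, \<open>q\<close>, \<open>N\<close> are in counterclockwise order, \<open>Arg (corner P q N)\<close> is the interior angle
  of the triangle at \<open>q\<close>.\<close>

definition corner :: "complex \<Rightarrow> complex \<Rightarrow> complex \<Rightarrow> complex" where
  "corner P q N = cnj (N - q) * (P - q)"

text \<open>The two coordinates are packed into one complex number, so that quarter turns of the
  square become multiplications by \<open>\<i>\<close>.\<close>

definition lincomb :: "complex \<Rightarrow> complex \<Rightarrow> complex \<Rightarrow> complex" where
  "lincomb u w z = complex_of_real (Re z) * u + complex_of_real (Im z) * w"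

text \<open>\<open>sq\<close> runs counterclockwise, one side per unit of time, along the boundary of the square with
  vertices \<open>\<plusminus>1 \<plusminus> \<i>\<close>; its image under \<open>lincomb u w\<close> bounds the parallelogram with half-sides
  \<open>u\<close> and \<open>w\<close>.\<close>

definition sq :: "real \<Rightarrow> complex" where
  "sq t = \<i> powi \<lfloor>t\<rfloor> * Complex 1 (2 * frac t - 1)"

section \<open>Angles of triangles inscribed in a parallelogram\<close>

lemma Im_corner_lincomb:
  "Im (corner (lincomb u w P) (lincomb u w q) (lincomb u w N)) =
     Im (cnj u * w) * Im (cnj (N - q) * (P - q))"
  by (simp add: corner_def lincomb_def algebra_simps)

lemma Re_corner_lincomb:
  "Re (corner (lincomb u w P) (lincomb u w q) (lincomb u w N)) =
     Re (N - q) * Re (P - q) * (cmod u)\<^sup>2 + Im (N - q) * Im (P - q) * (cmod w)\<^sup>2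
     + (Re (N - q) * Im (P - q) + Im (N - q) * Re (P - q)) * Re (cnj u * w)"
  unfolding cmod_power2 by (simp add: corner_def lincomb_def algebra_simps power2_eq_square)

lemma i_powi_cases: "\<i> powi n \<in> {1, \<i>, -1, -\<i>}"
proof -
  have "\<i> powi n = \<i> powi (4 * (n div 4) + n mod 4)" by simp
  also have "\<dots> = (\<i> powi 4) powi (n div 4) * \<i> powi (n mod 4)"
    by (subst power_int_add) (auto simp: power_int_mult)
  also have "\<i> powi 4 = 1" by (simp add: power_int_def)
  finally have *: "\<i> powi n = \<i> powi (n mod 4)" by simp
  have "n mod 4 \<in> {0, 1, 2, 3}" by auto
  then show ?thesis unfolding * by (auto simp: power_int_def numeral_3_eq_3)
qed

lemma sq_add_int: "sq (t + of_int n) = \<i> powi n * sq t"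
  by (simp add: sq_def power_int_add frac_def)

lemma sq_add_4: "sq (t + 4) = sq t"
proof -
  have "\<i> powi 4 = 1" by (simp add: power_int_def)
  then show ?thesis using sq_add_int[of t 4] by simp
qed

text \<open>A quarter turn of the square is absorbed by a change of half-sides; this reduces every
  configuration to one starting on the first side.\<close>

lemma lincomb_mult: "lincomb u w (\<iota> * z) = lincomb (lincomb u w \<iota>) (lincomb u w (\<i> * \<iota>)) z"
  by (simp add: lincomb_def algebra_simps complex_eq_iff)

text \<open>For \<open>Im V > 0\<close> the inequality \<open>E * Re V \<le> x * Im V\<close> says
  that the cotangent of the angle at the middle point is at most \<open>x / E\<close>. In every
  position \<open>Re V\<close> is a multiple of \<open>Re (cnj u * w)\<close>, with factor at most
  \<open>k\<close> in absolute value, plus terms in the squared half-sides. These terms are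
  nonpositive for outer points on equal or adjacent sides and at most \<open>M * k\<close> for
  opposite sides.\<close>

lemma corner_bounds_base:
  fixes u w :: complex and M :: real
  defines "E \<equiv> Im (cnj u * w)" and "D \<equiv> \<bar>Re (cnj u * w)\<bar>"
  assumes E: "E > 0" and M: "(cmod u)\<^sup>2 \<le> M" "(cmod w)\<^sup>2 \<le> M"
    and t: "0 \<le> tP" "tP < 1" "tP \<le> tq" "tq \<le> tN" "tN < 3"
    and V: "V = corner (lincomb u w (sq tP)) (lincomb u w (sq tq)) (lincomb u w (sq tN))"
  shows "Im V \<ge> 0" "E * Re V \<le> (M + D) * Im V" "tN < 2 \<Longrightarrow> E * Re V \<le> D * Im V"
proof -
  \<comment> \<open>Twice the signed area of the triangle in square coordinates; the parallelogram
    multiplies it by the determinant \<open>E\<close>.\<close>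
  define k where "k = Im (cnj (sq tN - sq tq) * (sq tP - sq tq))"
  have ImV: "Im V = E * k"
    unfolding V k_def E_def by (rule Im_corner_lincomb)
  note ReV = Re_corner_lincomb[of u w "sq tP" "sq tq" "sq tN", folded V]
  have s0: "sq t = Complex 1 (2 * t - 1)" if "0 \<le> t" "t < 1" for t
  proof -
    have "\<lfloor>t\<rfloor> = 0" using that by linarith
    then show ?thesis by (simp add: sq_def frac_def)
  qed
  have s1: "sq t = Complex (3 - 2 * t) 1" if "1 \<le> t" "t < 2" for t
  proof -
    have "\<lfloor>t\<rfloor> = 1" using that by linarith
    then show ?thesis by (simp add: sq_def frac_def complex_eq_iff)
  qed
  have s2: "sq t = Complex (-1) (5 - 2 * t)" if "2 \<le> t" "t < 3" for t
  proof -
    have "\<lfloor>t\<rfloor> = 2" using that by linarith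
    then show ?thesis by (simp add: sq_def frac_def power_int_def complex_eq_iff)
  qed
  let ?d = "Re (cnj u * w)"
  have d: "x * ?d \<le> x * D" "- (x * ?d) \<le> x * D" if "x \<ge> 0" for x
    using mult_left_mono[OF abs_ge_self that, of ?d] mult_left_mono[OF abs_ge_minus_self that, of ?d]
    unfolding D_def mult_minus_right by blast+
  have M0: "M \<ge> 0" using M(1) by (meson order_trans zero_le_power2)
  have main: "k \<ge> 0 \<and> Re V \<le> (M + D) * k \<and> (tN < 2 \<longrightarrow> Re V \<le> D * k)"
  proof (cases "tN < 2")
    case True
    have "k \<ge> 0 \<and> Re V \<le> D * k"
    proof (cases "tN < 1")
      case True
      have "k = 0" unfolding k_def using t True by (simp add: s0)
      moreover have "Re V = - (4 * (tN - tq) * (tq - tP) * (cmod w)\<^sup>2)"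
        unfolding ReV using t True by (simp add: s0 algebra_simps)
      ultimately show ?thesis using t by simp
    next
      case False
      show ?thesis
      proof (cases "tq < 1")
        case True
        have k: "k = 4 * (tN - 1) * (tq - tP)"
          unfolding k_def using t True False \<open>tN < 2\<close> by (simp add: s0 s1 algebra_simps)
        have R: "Re V = k * ?d - 4 * (1 - tq) * (tq - tP) * (cmod w)\<^sup>2"
          unfolding ReV k using t True False \<open>tN < 2\<close> by (simp add: s0 s1 algebra_simps)
        have "k \<ge> 0" "4 * (1 - tq) * (tq - tP) * (cmod w)\<^sup>2 \<ge> 0"
          unfolding k using t True False by simp_all
        then show ?thesis
          using d(1)[of k] R by (simp add: mult.commute[of D])
      next
        case Fq: False
        have k: "k = 4 * (tN - tq) * (1 - tP)"
          unfolding k_def using t Fq False \<open>tN < 2\<close> by (simp add: s0 s1 algebra_simps)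
        have R: "Re V = k * ?d - 4 * (tN - tq) * (tq - 1) * (cmod u)\<^sup>2"
          unfolding ReV k using t Fq False \<open>tN < 2\<close> by (simp add: s0 s1 algebra_simps)
        have "k \<ge> 0" "4 * (tN - tq) * (tq - 1) * (cmod u)\<^sup>2 \<ge> 0"
          unfolding k using t Fq False by simp_all
        then show ?thesis
          using d(1)[of k] R by (simp add: mult.commute[of D])
      qed
    qed
    moreover from this have "D * k \<le> (M + D) * k"
      using M0 by (intro mult_right_mono) auto
    ultimately show ?thesis by auto
  next
    case False
    have "k \<ge> 0 \<and> Re V \<le> (M + D) * k"
    proof -
      consider "tq < 1" | "1 \<le> tq" "tq < 2" | "2 \<le> tq" by linarith
      then show ?thesis
      proof cases
        case 1
        \<comment> \<open>\<open>p\<close> is the distance from P to q along the first side,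
          \<open>y\<close> the rise from q to N; \<open>- y \<le> 2\<close> because the square has
          sides of length 2.\<close>
        define p where "p = 2 * (tq - tP)"
        define y where "y = 6 - 2 * tN - 2 * tq"
        have p: "p \<ge> 0" and y: "y \<ge> -2" using t 1 by (auto simp: p_def y_def)
        have k: "k = 2 * p"
          unfolding k_def p_def using t 1 False by (simp add: s0 s2 algebra_simps)
        have k0: "k \<ge> 0" using k p by simp
        have "Re V = k * ?d + p * (- y) * (cmod w)\<^sup>2"
          unfolding ReV k p_def y_def using t 1 False by (simp add: s0 s2 algebra_simps)
        also have "\<dots> \<le> k * D + p * 2 * M"
        proof (intro add_mono)
          have "p * (- y) * (cmod w)\<^sup>2 \<le> p * 2 * (cmod w)\<^sup>2"
            using p y by (intro mult_right_mono mult_left_mono) auto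
          also have "\<dots> \<le> p * 2 * M"
            using p M by (intro mult_left_mono) auto
          finally show "p * (- y) * (cmod w)\<^sup>2 \<le> p * 2 * M" .
        qed (rule d(1)[OF k0])
        finally show ?thesis using p k by (simp add: algebra_simps)
      next
        case 2
        \<comment> \<open>Distances in square coordinates: \<open>x\<close> and \<open>x'\<close>
          from q to the ends of the top side, \<open>y\<close> and \<open>y'\<close> from N and P up
          to that side.\<close>
        define x x' y y' where "x = 4 - 2 * tq" and "x' = 2 * tq - 2"
          and "y = 2 * tN - 4" and "y' = 2 - 2 * tP"
        have b: "0 \<le> x" "0 \<le> x'" "x + x' = 2" "0 \<le> y" "y \<le> 2" "0 \<le> y'" "y' \<le> 2"
          using t 2 False by (auto simp: x_def x'_def y_def y'_def)
        have k: "k = x * y' + y * x'"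
          unfolding k_def x_def x'_def y_def y'_def using t 2 False by (simp add: s0 s1 s2 algebra_simps)
        have k0: "k \<ge> 0" unfolding k using b by simp
        \<comment> \<open>Writing 2 as \<open>x + x'\<close> splits the product, and
          \<open>y, y' \<le> 2\<close> bounds both parts.\<close>
        have "2 * (y * y') = x * y' * y + y * x' * y'"
          unfolding \<open>x + x' = 2\<close>[symmetric] by (simp add: algebra_simps)
        also have "\<dots> \<le> x * y' * 2 + y * x' * 2"
          using b by (intro add_mono mult_left_mono) auto
        finally have yy: "y * y' \<le> k" unfolding k by simp
        have "Re V = - (x * x' * (cmod u)\<^sup>2) + (x * y' * ?d - y * x' * ?d) + y * y' * (cmod w)\<^sup>2"
          unfolding ReV x_def x'_def y_def y'_def using t 2 False by (simp add: s0 s1 s2 algebra_simps)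
        also have "\<dots> \<le> 0 + k * D + k * M"
        proof (intro add_mono)
          show "- (x * x' * (cmod u)\<^sup>2) \<le> 0" using b by simp
          show "x * y' * ?d - y * x' * ?d \<le> k * D"
            using d(1)[of "x * y'"] d(2)[of "y * x'"] b unfolding k by (simp add: algebra_simps)
          show "y * y' * (cmod w)\<^sup>2 \<le> k * M"
            using yy M k0 by (intro mult_mono) auto
        qed
        finally show ?thesis using k0 by (simp add: algebra_simps)
      next
        case 3
        \<comment> \<open>Mirror image of the first case: now q and N share the left side.\<close>
        define n where "n = 2 * (tN - tq)"
        define y where "y = 2 * tP + 2 * tq - 6"
        have n: "n \<ge> 0" and y: "y \<ge> -2" using t 3 by (auto simp: n_def y_def)
        have k: "k = 2 * n"
          unfolding k_def n_def using t 3 by (simp add: s0 s2 algebra_simps)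
        have k0: "k \<ge> 0" using k n by simp
        have "Re V = - (k * ?d) + n * (- y) * (cmod w)\<^sup>2"
          unfolding ReV k n_def y_def using t 3 by (simp add: s0 s2 algebra_simps)
        also have "\<dots> \<le> k * D + n * 2 * M"
        proof (intro add_mono)
          have "n * (- y) * (cmod w)\<^sup>2 \<le> n * 2 * (cmod w)\<^sup>2"
            using n y by (intro mult_right_mono mult_left_mono) auto
          also have "\<dots> \<le> n * 2 * M"
            using n M by (intro mult_left_mono) auto
          finally show "n * (- y) * (cmod w)\<^sup>2 \<le> n * 2 * M" .
        qed (rule d(2)[OF k0])
        finally show ?thesis using n k by (simp add: algebra_simps)
      qed
    qed
    then show ?thesis using False by simp
  qed
  show "Im V \<ge> 0" using main E ImV by simp
  show "E * Re V \<le> (M + D) * Im V"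
    using main E mult_left_mono[of "Re V" "(M + D) * k" E] ImV by (simp add: algebra_simps)
  show "E * Re V \<le> D * Im V" if "tN < 2"
    using main E that mult_left_mono[of "Re V" "D * k" E] ImV by (simp add: algebra_simps)
qed

lemma corner_bounds:
  fixes u w :: complex and M :: real
  defines "E \<equiv> Im (cnj u * w)" and "D \<equiv> \<bar>Re (cnj u * w)\<bar>"
  assumes E: "E > 0" and M: "(cmod u)\<^sup>2 \<le> M" "(cmod w)\<^sup>2 \<le> M"
    and t: "tP \<le> tq" "tq \<le> tN" "\<lfloor>tN\<rfloor> \<le> \<lfloor>tP\<rfloor> + 2"
    and V: "V = corner (lincomb u w (sq tP)) (lincomb u w (sq tq)) (lincomb u w (sq tN))"
  shows "Im V \<ge> 0" "E * Re V \<le> (M + D) * Im V" "\<lfloor>tN\<rfloor> \<le> \<lfloor>tP\<rfloor> + 1 \<Longrightarrow> E * Re V \<le> D * Im V"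
proof -
  define \<iota> where "\<iota> = \<i> powi \<lfloor>tP\<rfloor>"
  define u' w' where "u' = lincomb u w \<iota>" and "w' = lincomb u w (\<i> * \<iota>)"
  have rot: "lincomb u w (sq t) = lincomb u' w' (sq (t - \<lfloor>tP\<rfloor>))" for t
    using sq_add_int[of "t - \<lfloor>tP\<rfloor>" "\<lfloor>tP\<rfloor>"]
    by (simp add: u'_def w'_def \<iota>_def flip: lincomb_mult)
  \<comment> \<open>A quarter turn replaces the pair \<open>u\<close>, \<open>w\<close> by
    \<open>w\<close>, \<open>- u\<close>: the determinant stays, and the sign change of the inner
    product is absorbed by the absolute value in \<open>D\<close>.\<close>
  have "\<iota> \<in> {1, \<i>, -1, -\<i>}" unfolding \<iota>_def by (rule i_powi_cases)
  then have eqs: "Im (cnj u' * w') = E" "\<bar>Re (cnj u' * w')\<bar> = D"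
      "(cmod u')\<^sup>2 \<le> M" "(cmod w')\<^sup>2 \<le> M"
    using M by (auto simp: u'_def w'_def lincomb_def E_def D_def algebra_simps)
  have b: "0 \<le> tP - \<lfloor>tP\<rfloor>" "tP - \<lfloor>tP\<rfloor> < 1" "tP - \<lfloor>tP\<rfloor> \<le> tq - \<lfloor>tP\<rfloor>" "tq - \<lfloor>tP\<rfloor> \<le> tN - \<lfloor>tP\<rfloor>"
      "tN - \<lfloor>tP\<rfloor> < 3"
    using t by linarith+
  note base = corner_bounds_base[of u' w' M, unfolded eqs, OF E eqs(3,4) b V[unfolded rot]]
  show "Im V \<ge> 0" "E * Re V \<le> (M + D) * Im V" by (fact base)+
  show "E * Re V \<le> D * Im V" if "\<lfloor>tN\<rfloor> \<le> \<lfloor>tP\<rfloor> + 1"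
    using that by (intro base(3)) linarith
qed

text \<open>Up to a positive factor, \<open>E * Re V - x * Im V\<close> is the sine of
  \<open>Arg (Complex x E) - Arg V\<close>. If that difference were positive, it would also be less
  than \<open>pi\<close> and its sine would be positive.\<close>

lemma Arg_ge_Arg:
  assumes V: "V \<noteq> 0" "Im V \<ge> 0" and E: "E > 0" and le: "E * Re V \<le> x * Im V"
  shows "Arg (Complex x E) \<le> Arg V"
proof (rule ccontr)
  let ?z = "Complex x E"
  assume "\<not> ?thesis"
  moreover have "0 \<le> Arg V" using V by (simp add: Arg_less_0)
  moreover have "0 < Arg ?z" "Arg ?z < pi"
    using E iffD2[OF Arg_lt_pi, of ?z] by auto
  ultimately have "sin (Arg ?z - Arg V) > 0"
    by (intro sin_gt_zero) auto
  moreover have z0: "?z \<noteq> 0" using E by (auto simp: complex_eq_iff)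
  ultimately have "cmod ?z * cmod V * sin (Arg ?z - Arg V) > 0" using V by simp
  also have "cmod ?z * cmod V * sin (Arg ?z - Arg V) =
      (cmod ?z * sin (Arg ?z)) * (cmod V * cos (Arg V)) - (cmod ?z * cos (Arg ?z)) * (cmod V * sin (Arg V))"
    by (simp add: sin_diff algebra_simps)
  also have "\<dots> = E * Re V - x * Im V"
    using V(1) z0 by (simp add: cos_Arg sin_Arg)
  finally show False using le by simp
qed

section \<open>The ratio of a quadrilateral and its opposite angles\<close>

text \<open>The product of two opposite corners is \<open>- (Y * cnj X)\<close>, so the law of
  cosines reads |X + Y|^2 = |X|^2 + |Y|^2 - 2 |X| |Y| cos f. Once cos f \<le> cos (2 \<omega>), the
  right side is at least (|X| + |Y|)^2 sin^2 \<omega>.\<close>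

lemma ptolemy_ratio_le_of_angle_sums:
  assumes dist: "distinct [a, b, c, d]"
    and \<omega>: "0 \<le> \<omega>" "\<omega> \<le> pi / 2"
    and ac: "2 * \<omega> \<le> Arg (corner d a b) + Arg (corner b c d)"
    and bd: "2 * \<omega> \<le> Arg (corner a b c) + Arg (corner c d a)"
  shows "(cmod (a - b) * cmod (c - d) + cmod (a - d) * cmod (b - c)) * sin \<omega> \<le> cmod (a - c) * cmod (b - d)"
proof -
  define X Y where "X = (a - b) * (c - d)" and "Y = (a - d) * (b - c)"
  define f g where "f = Arg (corner d a b) + Arg (corner b c d)"
    and "g = Arg (corner a b c) + Arg (corner c d a)"
  have pol: "V * W = of_real (cmod (V * W)) * cis (Arg V + Arg W)" for V W
  proof -
    have "V * W = (of_real (cmod V) * cis (Arg V)) * (of_real (cmod W) * cis (Arg W))"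
      by (simp flip: rcis_def add: rcis_cmod_Arg)
    then show ?thesis by (simp add: norm_mult cis_mult mult_ac)
  qed
  have VV: "corner d a b * corner b c d = - (Y * cnj X)" "corner a b c * corner c d a = - (X * cnj Y)"
    by (simp_all add: corner_def X_def Y_def algebra_simps)
  have F: "- (Y * cnj X) = of_real (cmod X * cmod Y) * cis f"
    using pol[of "corner d a b" "corner b c d"] unfolding f_def VV by (simp add: norm_mult mult_ac)
  have G: "- (X * cnj Y) = of_real (cmod X * cmod Y) * cis g"
    using pol[of "corner a b c" "corner c d a"] unfolding g_def VV by (simp add: norm_mult mult_ac)
  have XY: "X \<noteq> 0" "Y \<noteq> 0"
    using dist by (auto simp: X_def Y_def)
  then have pos: "cmod X * cmod Y > 0" by simp
  \<comment> \<open>The two products of opposite corners are conjugate, so \<open>f\<close> and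
    \<open>g\<close> are opposite modulo \<open>2 * pi\<close>.\<close>
  have "Re (- (Y * cnj X)) = Re (- (X * cnj Y))" "Im (- (Y * cnj X)) = - Im (- (X * cnj Y))"
    by (simp_all add: algebra_simps)
  then have cs: "cos f = cos g" "sin f = - sin g"
    unfolding F G using pos XY mult_left_cancel[of "cmod X * cmod Y" "sin f" "- sin g"] by auto
  have f2: "f \<le> 2 * pi" and g2: "g \<le> 2 * pi"
    using Arg_le_pi[of "corner d a b"] Arg_le_pi[of "corner b c d"]
      Arg_le_pi[of "corner a b c"] Arg_le_pi[of "corner c d a"] by (auto simp: f_def g_def)
  have sum: "X + Y = (a - c) * (b - d)" by (simp add: X_def Y_def algebra_simps)
  \<comment> \<open>Cosine decreases on [0, pi], so one angle sum in that range suffices. If both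
    exceed \<open>pi\<close>, the opposite sines leave only \<open>f = g = 2 * pi\<close>, with all
    four corners straight.\<close>
  have "cos f \<le> cos (2 * \<omega>)"
  proof (cases "f \<le> pi \<or> g \<le> pi")
    case True
    then show ?thesis
      using ac bd \<omega> cs(1) cos_monotone_0_pi_le[of "2 * \<omega>" f] cos_monotone_0_pi_le[of "2 * \<omega>" g]
      unfolding f_def[symmetric] g_def[symmetric] by linarith
  next
    case False
    have neg: "sin h < 0" if "pi < h" "h < 2 * pi" for h
      using sin_lt_zero that by simp
    have "f = 2 * pi \<and> g = 2 * pi"
    proof (rule ccontr)
      assume "\<not> ?thesis"
      then have "sin f < 0 \<and> sin g \<le> 0 \<or> sin f \<le> 0 \<and> sin g < 0"
        using neg[of f] neg[of g] False f2 g2 by (cases "f = 2 * pi"; cases "g = 2 * pi") auto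
      then show False using cs(2) by linarith
    qed
    then have "Arg (corner d a b) = pi" "Arg (corner b c d) = pi" "Arg (corner a b c) = pi" "Arg (corner c d a) = pi"
      using Arg_le_pi[of "corner d a b"] Arg_le_pi[of "corner b c d"]
        Arg_le_pi[of "corner a b c"] Arg_le_pi[of "corner c d a"] unfolding f_def g_def by linarith+
    then have neg: "Re (corner d a b) < 0" "Re (corner b c d) < 0" "Re (corner a b c) < 0"  "Re (corner c d a) < 0"
      by (auto simp: Arg_eq_pi)
    \<comment> \<open>By the law of cosines every side is then shorter than both diagonals, so
      \<open>X\<close> and \<open>Y\<close> are both shorter than \<open>X + Y\<close>. But
      \<open>X\<close> and \<open>Y\<close> point in opposite directions, which contradicts
      this.\<close>
    have obt: "cmod (N - q) < cmod (N - P) \<and> cmod (P - q) < cmod (N - P)" if "Re (corner P q N) < 0" for P q N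
    proof -
      have "(cmod (N - P))\<^sup>2 = (cmod (N - q))\<^sup>2 + (cmod (P - q))\<^sup>2 - 2 * Re (corner P q N)"
        unfolding cmod_power2 by (simp add: corner_def power2_eq_square algebra_simps)
      then have "(cmod (N - q))\<^sup>2 < (cmod (N - P))\<^sup>2" "(cmod (P - q))\<^sup>2 < (cmod (N - P))\<^sup>2"
        using that zero_le_power2[of "cmod (N - q)"] zero_le_power2[of "cmod (P - q)"] by linarith+
      then show ?thesis by (auto intro: power2_less_imp_less)
    qed
    have "cmod X < cmod (X + Y)" "cmod Y < cmod (X + Y)"
      unfolding sum unfolding X_def Y_def norm_mult
      using obt[OF neg(1)] obt[OF neg(2)] obt[OF neg(3)] obt[OF neg(4)]
      by (auto simp: norm_minus_commute intro!: mult_strict_mono')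
    moreover have "- (Y * cnj X) = of_real (cmod X * cmod Y)"
      using F \<open>f = 2 * pi \<and> g = 2 * pi\<close> by simp
    then have "Re (Y * cnj X) = - (cmod X * cmod Y)"
      by (metis Re_complex_of_real minus_equation_iff uminus_complex.sel(1))
    then have "(cmod (X + Y))\<^sup>2 = (cmod X - cmod Y)\<^sup>2"
      unfolding power2_diff cmod_power2 by (simp add: power2_eq_square algebra_simps)
    then have "cmod (X + Y) = \<bar>cmod X - cmod Y\<bar>"
      by (metis abs_norm_cancel power2_eq_iff_nonneg abs_ge_zero norm_ge_zero power2_abs)
    ultimately show ?thesis using norm_ge_zero[of X] norm_ge_zero[of Y] by linarith
  qed
  then have "cmod X * cmod Y * cos f \<le> cmod X * cmod Y * (1 - 2 * (sin \<omega>)\<^sup>2)"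
    using pos by (intro mult_left_mono) (auto simp: cos_double_sin)
  moreover have "cmod X * cmod Y * cos f = - Re (Y * cnj X)"
    using arg_cong[OF F, of Re] by simp
  ultimately have key: "- Re (Y * cnj X) \<le> cmod X * cmod Y * (1 - 2 * (sin \<omega>)\<^sup>2)" by simp
  have "((cmod X + cmod Y) * sin \<omega>)\<^sup>2 = (cmod X + cmod Y)\<^sup>2 * (sin \<omega>)\<^sup>2"
    by (simp add: power_mult_distrib)
  also have "\<dots> = (cmod X)\<^sup>2 + (cmod Y)\<^sup>2 - 2 * (cmod X * cmod Y * (1 - 2 * (sin \<omega>)\<^sup>2))
      - (cmod X - cmod Y)\<^sup>2 * (cos \<omega>)\<^sup>2"
    unfolding cos_squared_eq by (simp add: power2_eq_square algebra_simps)
  also have "\<dots> \<le> (cmod X)\<^sup>2 + (cmod Y)\<^sup>2 + 2 * Re (Y * cnj X)"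
  proof -
    have "(cmod X - cmod Y)\<^sup>2 * (cos \<omega>)\<^sup>2 \<ge> 0" by simp
    then show ?thesis using key by linarith
  qed
  also have "\<dots> = (cmod (X + Y))\<^sup>2"
    unfolding cmod_power2 by (simp add: power2_eq_square algebra_simps)
  finally have "(cmod X + cmod Y) * sin \<omega> \<le> cmod (X + Y)"
    by (rule power2_le_imp_le) simp
  then show ?thesis
    unfolding sum unfolding X_def Y_def norm_mult .
qed

text \<open>\<open>Complex (M + D) E\<close> is \<open>Complex D E\<close> shifted by
  \<open>M\<close>. If \<open>M\<close> equals the modulus of \<open>Complex D E\<close>, this is
  the diagonal of a rhombus and bisects the angle; a larger \<open>M\<close> makes the angle
  smaller.\<close>

lemma double_Arg_le:
  fixes D E M :: real
  assumes "E > 0" "D \<ge> 0" "M > 0" "E\<^sup>2 + D\<^sup>2 \<le> M\<^sup>2"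
  shows "2 * Arg (Complex (M + D) E) \<le> Arg (Complex D E)"
    and "0 \<le> Arg (Complex (M + D) E)" "Arg (Complex (M + D) E) \<le> pi / 2"
    and "sin (Arg (Complex (M + D) E)) = E / sqrt (E\<^sup>2 + (M + D)\<^sup>2)"
proof -
  let ?z = "Complex (M + D) E" and ?y = "Complex D E"
  have z0: "?z \<noteq> 0" "?y \<noteq> 0" using assms by (auto simp: complex_eq_iff)
  show 0: "0 \<le> Arg ?z" using assms by (simp add: Arg_less_0)
  have "Re ?z > 0" using assms by simp
  then have h: "\<bar>Arg ?z\<bar> < pi / 2" by (metis Arg_Re_pos)
  then show "Arg ?z \<le> pi / 2" by linarith
  show "sin (Arg ?z) = E / sqrt (E\<^sup>2 + (M + D)\<^sup>2)"
    using z0 by (simp add: sin_Arg cmod_def add.commute)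
  show "2 * Arg ?z \<le> Arg ?y"
  proof (rule ccontr)
    assume "\<not> ?thesis"
    moreover have "0 \<le> Arg ?y" using assms by (simp add: Arg_less_0)
    ultimately have "sin (2 * Arg ?z - Arg ?y) > 0"
      using h by (intro sin_gt_zero) auto
    then have "(cmod ?z)\<^sup>2 * cmod ?y * sin (2 * Arg ?z - Arg ?y) > 0" using z0 by simp
    also have "(cmod ?z)\<^sup>2 * cmod ?y * sin (2 * Arg ?z - Arg ?y) =
        2 * (cmod ?z * sin (Arg ?z)) * (cmod ?z * cos (Arg ?z)) * (cmod ?y * cos (Arg ?y))
        - ((cmod ?z * cos (Arg ?z))\<^sup>2 - (cmod ?z * sin (Arg ?z))\<^sup>2) * (cmod ?y * sin (Arg ?y))"
      unfolding sin_diff sin_double cos_double by (simp add: power2_eq_square algebra_simps)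
    also have "\<dots> = 2 * E * (M + D) * D - ((M + D)\<^sup>2 - E\<^sup>2) * E"
      using z0 by (simp add: cos_Arg sin_Arg)
    also have "\<dots> = E * ((E\<^sup>2 + D\<^sup>2) - M\<^sup>2)"
      by (simp add: power2_eq_square algebra_simps)
    also have "\<dots> \<le> 0"
      using assms by (simp add: mult_nonneg_nonpos)
    finally show False by simp
  qed
qed

section \<open>Cyclic order under two parametrizations of one curve\<close>

lemma continuous_sq: "continuous_on A sq"
proof -
  \<comment> \<open>On the closed interval from \<open>n\<close> to \<open>n + 1\<close> the map
    \<open>sq\<close> agrees with the continuous \<open>g n\<close>, as each side ends where the
    next begins.\<close>
  define g where "g n t = \<i> powi n * Complex 1 (2 * (t - of_int n) - 1)" for n :: int and t :: real
  have sq_g: "sq t = g n t" if "of_int n \<le> t" "t \<le> of_int n + 1" for n t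
  proof (cases "t = of_int n + 1")
    case True
    then have "sq t = \<i> powi (n + 1) * Complex 1 (-1)" by (simp add: sq_def)
    also have "\<dots> = \<i> powi n * (\<i> * Complex 1 (-1))" by (simp add: power_int_add)
    also have "\<i> * Complex 1 (-1) = Complex 1 1" by (simp add: complex_eq_iff)
    finally show ?thesis using True by (simp add: g_def)
  next
    case False
    then have "\<lfloor>t\<rfloor> = n" using that by linarith
    then show ?thesis by (simp add: sq_def g_def frac_def)
  qed
  have lim: "(sq \<longlongrightarrow> sq t) (at t within S)"
    if "of_int n \<le> t" "t \<le> of_int n + 1" "\<forall>\<^sub>F s in at t within S. of_int n \<le> s \<and> s \<le> of_int n + 1" for n t S
  proof -
    have "(g n \<longlongrightarrow> g n t) (at t within S)"
      unfolding g_def Complex_eq by (intro tendsto_intros)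
    moreover have "\<forall>\<^sub>F s in at t within S. sq s = g n s"
      using that(3) by eventually_elim (auto intro: sq_g)
    ultimately show ?thesis
      unfolding sq_g[OF that(1,2)] by (simp cong: filterlim_cong)
  qed
  have "continuous (at t) sq" for t
  proof -
    have "continuous (at_left t) sq"
    proof -
      \<comment> \<open>Rounding up makes an integer \<open>t\<close> the right end of its interval,
        as the left limit requires.\<close>
      define n where "n = \<lceil>t\<rceil> - 1"
      have n: "of_int n < t" "t \<le> of_int n + 1" unfolding n_def by linarith+
      have "\<forall>\<^sub>F s in at_left t. of_int n \<le> s \<and> s \<le> of_int n + 1"
        using eventually_at_left_real[OF n(1)] by eventually_elim (use n in auto)
      then show ?thesis unfolding continuous_within using n by (intro lim[of n]) auto
    qed
    moreover have "continuous (at_right t) sq"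
    proof -
      define n where "n = \<lfloor>t\<rfloor>"
      have n: "of_int n \<le> t" "t < of_int n + 1" unfolding n_def by linarith+
      have "\<forall>\<^sub>F s in at_right t. of_int n \<le> s \<and> s \<le> of_int n + 1"
        using eventually_at_right_real[OF n(2)] by eventually_elim (use n in auto)
      then show ?thesis unfolding continuous_within using n by (intro lim[of n]) auto
    qed
    ultimately show ?thesis by (simp add: continuous_at_split)
  qed
  then show ?thesis by (simp add: continuous_at_imp_continuous_on)
qed

text \<open>What is carried over from \<open>\<gamma>\<close> to \<open>f\<close> is that the pair
  \<open>\<gamma> t1\<close>, \<open>\<gamma> t3\<close> alternates with \<open>\<gamma> t2\<close>,
  \<open>\<gamma> t4\<close>. Let \<open>f\<close> pass the second pair at times \<open>x\<close>
  and \<open>y\<close>. By \<open>simple_path_separation\<close> each of the two arcs of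
  \<open>f\<close> between them contains a point of the first pair; since the arcs cover the curve,
  these points can be chosen different.\<close>

lemma simple_path_order_periodic:
  fixes \<gamma> f :: "real \<Rightarrow> 'a::t2_space"
  assumes \<gamma>: "simple_path \<gamma>"
    and t: "0 \<le> t1" "t1 < t2" "t2 < t3" "t3 < t4" "t4 < 1"
    and f: "continuous_on UNIV f" "\<And>t. f (t + 4) = f t" "path_image \<gamma> = range f"
    and dist: "distinct [\<gamma> t1, \<gamma> t2, \<gamma> t3, \<gamma> t4]"
  obtains ta tb tc td where "ta < tb" "tb < tc" "tc < td" "td < ta + 4"
    "f ta = \<gamma> t1 \<and> f tc = \<gamma> t3 \<or> f ta = \<gamma> t3 \<and> f tc = \<gamma> t1"
    "f tb = \<gamma> t2 \<and> f td = \<gamma> t4 \<or> f tb = \<gamma> t4 \<and> f td = \<gamma> t2"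
proof -
  note result = that
  have shift: "f (t + 4 * of_int n) = f t" for t and n :: int
  proof (induction n rule: int_induct[where k = 0])
    case (step1 i)
    then show ?case using f(2)[of "t + 4 * of_int i"] by (simp add: algebra_simps)
  next
    case (step2 i)
    then show ?case using f(2)[of "t + 4 * of_int (i - 1)"] by (simp add: algebra_simps)
  qed simp
  have window: "\<exists>t. s \<le> t \<and> t < s + 4 \<and> f t = z" if "z \<in> range f" for z s
  proof -
    obtain t where t: "z = f t" using \<open>z \<in> range f\<close> by auto
    define n where "n = \<lfloor>(t - s) / 4\<rfloor>"
    have "of_int n \<le> (t - s) / 4" "(t - s) / 4 < of_int n + 1"
      unfolding n_def by linarith+
    then have "s \<le> t + 4 * of_int (- n)" "t + 4 * of_int (- n) < s + 4"
      by (simp_all add: field_simps)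
    then show ?thesis using shift[of t "- n"] t by auto
  qed
  have on: "\<gamma> t \<in> range f" if "0 \<le> t" "t < 1" for t
    using that f(3) by (auto simp: path_image_def)
  have sep: "\<gamma> t1 \<in> f ` {x..y} \<or> \<gamma> t3 \<in> f ` {x..y}"
    if "\<gamma> t2 \<in> f ` {x..y}" "\<gamma> t4 \<in> f ` {x..y}" for x y
  proof (rule simple_path_separation[OF \<gamma> t _ _ that])
    show "connected (f ` {x..y})"
      by (intro connected_continuous_image continuous_on_subset[OF f(1)]) auto
    show "f ` {x..y} \<subseteq> path_image \<gamma>" using f(3) by auto
  qed
  have main: thesis
    if x: "0 \<le> x" "x < y" "y < x + 4" and xy: "f x = \<gamma> t2 \<and> f y = \<gamma> t4 \<or> f x = \<gamma> t4 \<and> f y = \<gamma> t2" for x y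
  proof -
    have arc1: "\<gamma> t1 \<in> f ` {x..y} \<or> \<gamma> t3 \<in> f ` {x..y}"
      using x xy by (intro sep) (metis atLeastAtMost_iff imageI less_imp_le order_refl)+
    have arc2: "\<gamma> t1 \<in> f ` {y..x + 4} \<or> \<gamma> t3 \<in> f ` {y..x + 4}"
      using x xy f(2)[of x] by (intro sep) (metis atLeastAtMost_iff imageI less_imp_le order_refl)+
    have cover: "z \<in> f ` {x..y} \<or> z \<in> f ` {y..x + 4}" if "z \<in> range f" for z
      using window[OF that, of x] by (metis atLeastAtMost_iff imageI linear less_imp_le)
    have "\<gamma> t1 \<in> f ` {x..y} \<and> \<gamma> t3 \<in> f ` {y..x + 4} \<or> \<gamma> t3 \<in> f ` {x..y} \<and> \<gamma> t1 \<in> f ` {y..x + 4}"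
      using arc1 arc2 cover[OF on, of t1] cover[OF on, of t3] t by auto
    then obtain s s' where s: "s \<in> {x..y}" "s' \<in> {y..x + 4}"
        "f s = \<gamma> t1 \<and> f s' = \<gamma> t3 \<or> f s = \<gamma> t3 \<and> f s' = \<gamma> t1"
      by (elim disjE conjE imageE) (metis (no_types))+
    have "s \<noteq> x" "s \<noteq> y" "s' \<noteq> y" "s' \<noteq> x + 4"
      using s(3) xy dist f(2)[of x] by auto
    \<comment> \<open>Going back one period from \<open>s'\<close> gives the order
      \<open>s' - 4 < x < s < y\<close> within one period.\<close>
    moreover have "f (s' - 4) = f s'" using f(2)[of "s' - 4"] by simp
    ultimately show thesis
      using s xy by (intro result[of "s' - 4" x s y]) auto
  qed
  obtain x where x: "0 \<le> x" "x < 0 + 4" "f x = \<gamma> t2" using window[OF on, of t2 0] t by auto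
  obtain y where y: "0 \<le> y" "y < 0 + 4" "f y = \<gamma> t4" using window[OF on, of t4 0] t by auto
  have "x \<noteq> y" using x(3) y(3) dist by auto
  then consider "x < y" | "y < x" by linarith
  then show thesis
    using main[of x y] main[of y x] x y by cases auto
qed

section \<open>Opposite angles of an inscribed quadrilateral\<close>

lemma lincomb_sq_add_4: "lincomb u w (sq (t + 4)) = lincomb u w (sq t)"
  by (simp add: sq_add_4)

text \<open>Both sides are twice the signed area of the triangle.\<close>

lemma Im_corner_rotate: "Im (corner P q N) = Im (corner N P q)"
  by (simp add: corner_def algebra_simps)

text \<open>\<open>corner_bounds\<close> covers triples spread over at most three consecutive sides.
  Around the loop the three gaps between side numbers add up to 4, so one is at least 2; starting
  the triple after that gap brings it into range.\<close>

lemma Im_corner_sq_nonneg: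
  fixes u w :: complex
  defines "f \<equiv> \<lambda>t. lincomb u w (sq t)"
  assumes E: "Im (cnj u * w) > 0" and t: "tP \<le> tq" "tq \<le> tN" "tN \<le> tP + 4"
  shows "Im (corner (f tP) (f tq) (f tN)) \<ge> 0"
proof -
  have pos: "Im (corner (f x) (f y) (f z)) \<ge> 0" if "x \<le> y" "y \<le> z" "\<lfloor>z\<rfloor> \<le> \<lfloor>x\<rfloor> + 2" for x y z
    unfolding f_def
    by (rule corner_bounds(1)[OF E _ _ that refl, of "max ((cmod u)\<^sup>2) ((cmod w)\<^sup>2)"]) auto
  have f4: "f (t - 4) = f t" "f (t + 4) = f t" for t
    using lincomb_sq_add_4[of u w "t - 4"] lincomb_sq_add_4[of u w t] by (simp_all add: f_def)
  have "\<lfloor>tN - 4\<rfloor> = \<lfloor>tN\<rfloor> - 4" "\<lfloor>tP + 4\<rfloor> = \<lfloor>tP\<rfloor> + 4" by linarith+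
  then consider "\<lfloor>tN\<rfloor> \<le> \<lfloor>tP\<rfloor> + 2" | "\<lfloor>tq\<rfloor> \<le> \<lfloor>tN - 4\<rfloor> + 2" | "\<lfloor>tP + 4\<rfloor> \<le> \<lfloor>tq\<rfloor> + 2"
    by linarith
  then show ?thesis
  proof cases
    case 1
    then show ?thesis using t by (intro pos)
  next
    case 2
    then have "Im (corner (f (tN - 4)) (f tP) (f tq)) \<ge> 0" using t by (intro pos) auto
    then show ?thesis by (simp add: f4 Im_corner_rotate[of "f tP"])
  next
    case 3
    then have "Im (corner (f tq) (f tN) (f (tP + 4))) \<ge> 0" using t by (intro pos) auto
    then show ?thesis by (simp add: f4 Im_corner_rotate[of "f tq"])
  qed
qed

text \<open>Two points on the same or on adjacent sides are seen from the arc between them under an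
  angle of at least the smallest inner angle; two points on opposite sides are seen from either arc
  under an angle of at least \<open>Arg (Complex (M + D) E)\<close>.\<close>

lemma opposite_angles_sum_ge:
  fixes u w :: complex and M :: real
  defines "E \<equiv> Im (cnj u * w)" and "D \<equiv> \<bar>Re (cnj u * w)\<bar>" and "f \<equiv> \<lambda>t. lincomb u w (sq t)"
  assumes E: "E > 0" and M: "(cmod u)\<^sup>2 \<le> M" "(cmod w)\<^sup>2 \<le> M" "M > 0" "E\<^sup>2 + D\<^sup>2 \<le> M\<^sup>2"
    and t: "ta < tb" "tb < tc" "tc < td" "td < ta + 4"
    and dist: "distinct [f ta, f tb, f tc, f td]"
  shows "2 * Arg (Complex (M + D) E) \<le> Arg (corner (f td) (f ta) (f tb)) + Arg (corner (f tb) (f tc) (f td))"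
proof -
  have D0: "D \<ge> 0" unfolding D_def by simp
  have f4: "f (t - 4) = f t" for t
    using lincomb_sq_add_4[of u w "t - 4"] by (simp add: f_def)
  define Va Vc where "Va = corner (f td) (f ta) (f tb)" and "Vc = corner (f tb) (f tc) (f td)"
  have Va: "Va = corner (f (td - 4)) (f ta) (f tb)" by (simp add: Va_def f4)
  have nz: "Va \<noteq> 0" "Vc \<noteq> 0" using dist by (auto simp: Va_def Vc_def corner_def)
  have I: "Im Va \<ge> 0" "Im Vc \<ge> 0"
    using Im_corner_sq_nonneg[OF E[unfolded E_def], of "td - 4" ta tb]
      Im_corner_sq_nonneg[OF E[unfolded E_def], of tb tc td] t
    by (auto simp: Va Vc_def f_def)
  then have A0: "Arg Va \<ge> 0" "Arg Vc \<ge> 0" by (auto simp: Arg_less_0)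
  note bnd = corner_bounds[OF E[unfolded E_def] M(1,2), folded E_def D_def]
  note dbl = double_Arg_le[OF E D0 M(3,4)]
  have fl: "\<lfloor>td - 4\<rfloor> = \<lfloor>td\<rfloor> - 4" by linarith
  \<comment> \<open>From \<open>td - 4\<close> to \<open>tb\<close> the side number grows by 4 minus
    its growth from \<open>tb\<close> to \<open>td\<close>: by 2 in the middle case, by at most 1 in
    the last. In the outer cases one angle alone reaches the bound, the other being
    nonnegative.\<close>
  consider "\<lfloor>td\<rfloor> \<le> \<lfloor>tb\<rfloor> + 1" | "\<lfloor>td\<rfloor> = \<lfloor>tb\<rfloor> + 2" | "\<lfloor>td\<rfloor> \<ge> \<lfloor>tb\<rfloor> + 3" by linarith
  then have "2 * Arg (Complex (M + D) E) \<le> Arg Va + Arg Vc"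
  proof cases
    case 1
    have "E * Re Vc \<le> D * Im Vc"
      by (rule bnd(3)[of tb tc td]) (use t 1 in \<open>auto simp: Vc_def f_def\<close>)
    then show ?thesis using Arg_ge_Arg[OF nz(2) I(2) E] dbl(1) A0 by fastforce
  next
    case 2
    have "E * Re Vc \<le> (M + D) * Im Vc"
      by (rule bnd(2)[of tb tc td]) (use t 2 in \<open>auto simp: Vc_def f_def\<close>)
    moreover have "E * Re Va \<le> (M + D) * Im Va"
      by (rule bnd(2)[of "td - 4" ta tb]) (use t 2 in \<open>auto simp: Va f_def\<close>)
    ultimately show ?thesis
      using Arg_ge_Arg[OF nz(2) I(2) E, of "M + D"] Arg_ge_Arg[OF nz(1) I(1) E, of "M + D"] by simp
  next
    case 3
    have "E * Re Va \<le> D * Im Va"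
      by (rule bnd(3)[of "td - 4" ta tb]) (use t 3 in \<open>auto simp: Va f_def fl\<close>)
    then show ?thesis using Arg_ge_Arg[OF nz(1) I(1) E] dbl(1) A0 by fastforce
  qed
  then show ?thesis by (simp add: Va_def Vc_def)
qed

lemma lagrange_identity: "(Im (cnj u * w))\<^sup>2 + (Re (cnj u * w))\<^sup>2 = (cmod u)\<^sup>2 * (cmod w)\<^sup>2"
  unfolding cmod_power2 by (simp add: power2_eq_square algebra_simps)

text \<open>Both sums of opposite angles are at least twice \<open>Arg (Complex (M + D) E)\<close>,
  and the bound is the reciprocal of the sine of that angle.\<close>

lemma ptolemy_inequality_sq:
  fixes u w :: complex and M :: real
  defines "E \<equiv> Im (cnj u * w)" and "D \<equiv> \<bar>Re (cnj u * w)\<bar>" and "f \<equiv> \<lambda>t. lincomb u w (sq t)"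
  assumes E: "E > 0" and M: "(cmod u)\<^sup>2 \<le> M" "(cmod w)\<^sup>2 \<le> M"
    and t: "ta < tb" "tb < tc" "tc < td" "td < ta + 4"
    and abcd: "a = f ta" "b = f tb" "c = f tc" "d = f td"
    and dist: "distinct [a, b, c, d]"
  shows "ptol a b c d \<le> sqrt (E\<^sup>2 + (M + D)\<^sup>2) / E"
proof -
  define \<omega> where "\<omega> = Arg (Complex (M + D) E)"
  have D0: "D \<ge> 0" unfolding D_def by simp
  have ED: "E\<^sup>2 + D\<^sup>2 = (cmod u)\<^sup>2 * (cmod w)\<^sup>2"
    unfolding E_def D_def power2_abs by (rule lagrange_identity)
  also have "\<dots> \<le> M * M"
    using M by (intro mult_mono) (auto intro: order_trans[OF zero_le_power2])
  finally have EM: "E\<^sup>2 + D\<^sup>2 \<le> M\<^sup>2" by (simp add: power2_eq_square)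
  have "u \<noteq> 0" using E by (auto simp: E_def)
  then have M0: "M > 0" using less_le_trans[OF _ M(1), of 0] by simp
  note dbl = double_Arg_le[OF E D0 M0 EM, folded \<omega>_def]
  have f4: "f (t + 4) = f t" for t by (simp add: f_def lincomb_sq_add_4)
  have s: "sqrt (E\<^sup>2 + (M + D)\<^sup>2) > 0" using E by (auto intro!: real_sqrt_gt_zero add_pos_nonneg)
  have op: "2 * \<omega> \<le> Arg (corner (f z) (f v) (f x)) + Arg (corner (f x) (f y) (f z))"
    if "v < x" "x < y" "y < z" "z < v + 4" "distinct [f v, f x, f y, f z]" for v x y z
    using opposite_angles_sum_ge[OF E[unfolded E_def] M M0 EM[unfolded E_def D_def]] that
    unfolding f_def E_def D_def \<omega>_def by blast
  have "(cmod (a - b) * cmod (c - d) + cmod (a - d) * cmod (b - c)) * sin \<omega> \<le> cmod (a - c) * cmod (b - d)"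
  proof (rule ptolemy_ratio_le_of_angle_sums[OF dist])
    show "0 \<le> \<omega>" "\<omega> \<le> pi / 2" by (fact dbl)+
    show "2 * \<omega> \<le> Arg (corner d a b) + Arg (corner b c d)"
      using op[of ta tb tc td] t dist by (simp add: abcd)
    \<comment> \<open>The same quadrilateral started at \<open>b\<close>, so that \<open>a\<close>
      is reached one period later.\<close>
    show "2 * \<omega> \<le> Arg (corner a b c) + Arg (corner c d a)"
      using op[of tb tc td "ta + 4"] t dist by (auto simp: abcd f4)
  qed
  then show ?thesis
    using dist E s unfolding dbl(4) ptol_def by (simp add: divide_simps mult_ac)
qed

section \<open>The boundary of a parallelogram\<close>

lemma linear_lincomb: "linear (lincomb u w)"
  by (rule linearI) (simp_all add: lincomb_def algebra_simps scaleR_conv_of_real)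

text \<open>Cramer's rule for the inverse of \<open>lincomb u w\<close>, whose determinant is
  \<open>Im (cnj u * w)\<close>.\<close>

definition coord :: "complex \<Rightarrow> complex \<Rightarrow> complex \<Rightarrow> complex" where
  "coord u w v = Complex (Im (cnj v * w) / Im (cnj u * w)) (Im (cnj u * v) / Im (cnj u * w))"

lemma lincomb_coord:
  assumes "Im (cnj u * w) \<noteq> 0"
  shows "lincomb u w (coord u w v) = v"
proof -
  have "of_real (Im (cnj u * w)) * lincomb u w (coord u w v) =
      of_real (Im (cnj v * w)) * u + of_real (Im (cnj u * v)) * w"
  proof -
    have "of_real e * (of_real (x / e) * u + of_real (y / e) * w) = of_real x * u + of_real y * w"
      if "e \<noteq> 0" for e x y :: real
      using that by (simp add: ring_distribs)
    then show ?thesis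
      using assms unfolding lincomb_def coord_def complex.sel by blast
  qed
  also have "\<dots> = of_real (Im (cnj u * w)) * v"
    by (simp add: complex_eq_iff algebra_simps)
  finally show ?thesis
    using assms unfolding mult_cancel_left of_real_eq_0_iff by blast
qed

lemma coord_lincomb:
  assumes "Im (cnj u * w) \<noteq> 0"
  shows "coord u w (lincomb u w z) = z"
proof -
  have "Im (cnj (lincomb u w z) * w) = Re z * Im (cnj u * w)"
    "Im (cnj u * lincomb u w z) = Im z * Im (cnj u * w)"
    by (simp_all add: lincomb_def algebra_simps)
  then show ?thesis using assms by (simp add: coord_def complex_eq_iff)
qed

lemma inj_lincomb: "Im (cnj u * w) \<noteq> 0 \<Longrightarrow> inj (lincomb u w)"
  by (metis coord_lincomb injI)

definition maxnorm :: "complex \<Rightarrow> real" where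
  "maxnorm z = max \<bar>Re z\<bar> \<bar>Im z\<bar>"

lemma convex_hull_square:
  "convex hull {Complex (-1) (-1), Complex 1 (-1), Complex 1 1, Complex (-1) 1} = {z. maxnorm z \<le> 1}"
  (is "convex hull ?V = _")
proof
  have cb: "{z. maxnorm z \<le> 1} = cbox (Complex (-1) (-1)) (Complex 1 1)"
    by (auto simp: maxnorm_def in_cbox_complex_iff abs_le_iff)
  show "convex hull ?V \<subseteq> {z. maxnorm z \<le> 1}"
    by (rule hull_minimal) (auto simp: cb convex_box, auto simp: in_cbox_complex_iff)
  show "{z. maxnorm z \<le> 1} \<subseteq> convex hull ?V"
  proof safe
    fix z assume z: "maxnorm z \<le> 1"
    then have b: "-1 \<le> Re z" "Re z \<le> 1" "-1 \<le> Im z" "Im z \<le> 1" by (auto simp: maxnorm_def)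
    have H: "x \<in> convex hull ?V" if "x \<in> ?V" for x using that by (rule hull_inc)
    have comb: "((1 - s) / 2) *\<^sub>R x + ((1 + s) / 2) *\<^sub>R y \<in> convex hull ?V"
      if "x \<in> convex hull ?V" "y \<in> convex hull ?V" "-1 \<le> s" "s \<le> 1" for x y s
      using that by (intro convexD[OF convex_convex_hull]) (auto simp: field_simps)
    \<comment> \<open>Bilinear interpolation: along the two vertical edges first, then between
      them.\<close>
    have "((1 - Re z) / 2) *\<^sub>R (((1 - Im z) / 2) *\<^sub>R Complex (-1) (-1) + ((1 + Im z) / 2) *\<^sub>R Complex (-1) 1) +
        ((1 + Re z) / 2) *\<^sub>R (((1 - Im z) / 2) *\<^sub>R Complex 1 (-1) + ((1 + Im z) / 2) *\<^sub>R Complex 1 1)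
        \<in> convex hull ?V"
      using b by (intro comb H) auto
    also have "((1 - Re z) / 2) *\<^sub>R (((1 - Im z) / 2) *\<^sub>R Complex (-1) (-1) + ((1 + Im z) / 2) *\<^sub>R Complex (-1) 1) +
        ((1 + Re z) / 2) *\<^sub>R (((1 - Im z) / 2) *\<^sub>R Complex 1 (-1) + ((1 + Im z) / 2) *\<^sub>R Complex 1 1) = z"
      by (simp add: complex_eq_iff field_simps)
    finally show "z \<in> convex hull ?V" .
  qed
qed

lemma interior_square: "interior {z. maxnorm z \<le> 1} = {z. maxnorm z < 1}"
proof -
  have "{z. maxnorm z \<le> 1} = cbox (Complex (-1) (-1)) (Complex 1 1)"
    by (auto simp: maxnorm_def in_cbox_complex_iff abs_le_iff)
  moreover have "{z. maxnorm z < 1} = box (Complex (-1) (-1)) (Complex 1 1)"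
    by (auto simp: maxnorm_def in_box_complex_iff abs_less_iff)
  ultimately show ?thesis by (simp add: interior_cbox)
qed

lemma frontier_square: "frontier {z. maxnorm z < 1} = {z. maxnorm z = 1}"
proof -
  have "{z. maxnorm z < 1} = box (Complex (-1) (-1)) (Complex 1 1)"
    by (auto simp: maxnorm_def in_box_complex_iff abs_less_iff)
  moreover have "0 \<in> box (Complex (-1) (-1)) (Complex 1 1)"
    by (simp add: in_box_complex_iff)
  ultimately have "frontier {z. maxnorm z < 1} = cbox (Complex (-1) (-1)) (Complex 1 1) - box (Complex (-1) (-1)) (Complex 1 1)"
    by (auto simp: frontier_box)
  also have "\<dots> = {z. maxnorm z = 1}"
    by (auto simp: maxnorm_def in_box_complex_iff in_cbox_complex_iff)
  finally show ?thesis .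
qed

text \<open>With \<open>u\<close> and \<open>w\<close> as half-sides, the parallelogram is the image
  of the square under an injective affine map sending 0 to the centre \<open>p + u + w\<close>; such
  maps commute with hulls and interiors.\<close>

lemma parallelogram_interior:
  assumes "Im (cnj u * w) \<noteq> 0"
  shows "interior (convex hull {p, p + 2 * u, p + 2 * u + 2 * w, p + 2 * w}) =
    (\<lambda>z. p + u + w + lincomb u w z) ` {z. maxnorm z < 1}"
proof -
  have "{p, p + 2 * u, p + 2 * u + 2 * w, p + 2 * w} =
      (+) (p + u + w) ` lincomb u w ` {Complex (-1) (-1), Complex 1 (-1), Complex 1 1, Complex (-1) 1}"
    by (simp add: lincomb_def algebra_simps)
  then have "interior (convex hull {p, p + 2 * u, p + 2 * u + 2 * w, p + 2 * w}) =
      (+) (p + u + w) ` lincomb u w ` {z. maxnorm z < 1}"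
    by (simp only: convex_hull_translation convex_hull_linear_image[OF linear_lincomb, symmetric]
        convex_hull_square interior_translation interior_square
        interior_injective_linear_image[OF linear_lincomb inj_lincomb[OF assms]])
  then show ?thesis by (simp add: image_image)
qed

lemma parallelogram_frontier:
  assumes "Im (cnj u * w) \<noteq> 0"
  shows "frontier (interior (convex hull {p, p + 2 * u, p + 2 * u + 2 * w, p + 2 * w})) =
    (\<lambda>z. p + u + w + lincomb u w z) ` {z. maxnorm z = 1}"
proof -
  have lin: "frontier (lincomb u w ` S) = lincomb u w ` frontier S" for S
    unfolding frontier_def
    by (simp add: closure_injective_linear_image[OF linear_lincomb inj_lincomb[OF assms]]
        interior_injective_linear_image[OF linear_lincomb inj_lincomb[OF assms]]
        image_set_diff[OF inj_lincomb[OF assms]])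
  have "(\<lambda>z. p + u + w + lincomb u w z) ` S = (+) (p + u + w) ` lincomb u w ` S" for S
    by (simp add: image_image)
  then show ?thesis
    unfolding parallelogram_interior[OF assms] by (simp only: frontier_translation lin frontier_square)
qed

lemma range_sq: "range sq = {z. maxnorm z = 1}"
proof
  show "range sq \<subseteq> {z. maxnorm z = 1}"
  proof safe
    fix t :: real
    have "\<bar>2 * frac t - 1\<bar> \<le> 1" using frac_ge_0[of t] frac_lt_1[of t] by linarith
    then show "maxnorm (sq t) = 1"
      using i_powi_cases[of "\<lfloor>t\<rfloor>"] by (auto simp: sq_def maxnorm_def)
  qed
  show "{z. maxnorm z = 1} \<subseteq> range sq"
  proof safe
    have e: "Complex 1 y \<in> range sq" if "-1 \<le> y" "y \<le> 1" for y
    \<comment> \<open>\<open>sq\<close> is defined on half-open unit intervals, so the corner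
      \<open>y = 1\<close> belongs to the next side.\<close>
    proof (cases "y = 1")
      case True
      then have "Complex 1 y = sq 1" by (simp add: sq_def complex_eq_iff)
      then show ?thesis by simp
    next
      case False
      then have "\<lfloor>(1 + y) / 2\<rfloor> = 0" using that by (simp add: floor_eq_iff)
      then have "sq ((1 + y) / 2) = Complex 1 y" by (simp add: sq_def frac_def field_simps)
      then show ?thesis by (metis rangeI)
    qed
    have rot: "\<i> powi n * z \<in> range sq" if "z \<in> range sq" for z n
      using that by (auto simp flip: sq_add_int)
    fix z assume "maxnorm z = 1"
    then have "\<bar>Re z\<bar> \<le> 1" "\<bar>Im z\<bar> \<le> 1" "Re z = 1 \<or> Re z = -1 \<or> Im z = 1 \<or> Im z = -1"
      by (auto simp: maxnorm_def max_def abs_if split: if_splits)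
    then consider "z = Complex 1 (Im z)" "\<bar>Im z\<bar> \<le> 1" | "z = \<i> powi 2 * Complex 1 (- Im z)" "\<bar>Im z\<bar> \<le> 1"
      | "z = \<i> powi 1 * Complex 1 (- Re z)" "\<bar>Re z\<bar> \<le> 1" | "z = \<i> powi (-1) * Complex 1 (Re z)" "\<bar>Re z\<bar> \<le> 1"
      by (auto simp: complex_eq_iff power_int_def)
    then show "z \<in> range sq"
    proof cases
      case 1
      then show ?thesis using e[of "Im z"] by auto
    next
      case 2
      then show ?thesis using rot[OF e[of "- Im z"], of 2] by auto
    next
      case 3
      then show ?thesis using rot[OF e[of "- Re z"], of 1] by auto
    next
      case 4
      then show ?thesis using rot[OF e[of "Re z"], of "- 1"] by auto
    qed
  qed
qed

section \<open>The boundary loop and its winding\<close>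

text \<open>The Minkowski functional of the parallelogram with half-sides \<open>u\<close> and
  \<open>w\<close> centred at 0.\<close>

definition gauge_at :: "complex \<Rightarrow> complex \<Rightarrow> complex \<Rightarrow> real" where
  "gauge_at u w v = maxnorm (coord u w v)"

lemma gauge_scale: "gauge_at u w (of_real c * v) = \<bar>c\<bar> * gauge_at u w v"
proof -
  have "coord u w (of_real c * v) = of_real c * coord u w v"
    by (simp add: coord_def complex_eq_iff algebra_simps diff_divide_distrib add_divide_distrib)
  then show ?thesis
    by (simp add: gauge_at_def maxnorm_def abs_mult max_mult_distrib_left)
qed

lemma gauge_minus: "gauge_at u w (- v) = gauge_at u w v"
  using gauge_scale[of u w "-1" v] by simp

lemma continuous_on_gauge [continuous_intros]:
  "continuous_on S h \<Longrightarrow> continuous_on S (\<lambda>t. gauge_at u w (h t))"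
  unfolding gauge_at_def maxnorm_def coord_def by (auto intro!: continuous_intros simp: divide_inverse)

lemma gauge_pos:
  assumes "Im (cnj u * w) \<noteq> 0" "v \<noteq> 0"
  shows "gauge_at u w v > 0"
proof -
  have "coord u w v \<noteq> 0"
    using lincomb_coord[OF assms(1), of v] assms(2) by (auto simp: lincomb_def)
  then show ?thesis by (auto simp: gauge_at_def maxnorm_def complex_eq_iff max_def)
qed

lemma gauge_image_iff:
  assumes "Im (cnj u * w) \<noteq> 0"
  shows "v \<in> (\<lambda>z. m + lincomb u w z) ` {z. P (maxnorm z)} \<longleftrightarrow> P (gauge_at u w (v - m))"
proof
  assume "v \<in> (\<lambda>z. m + lincomb u w z) ` {z. P (maxnorm z)}"
  then show "P (gauge_at u w (v - m))"
    using assms by (auto simp: gauge_at_def coord_lincomb)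
next
  assume *: "P (gauge_at u w (v - m))"
  have "v = m + lincomb u w (coord u w (v - m))" using lincomb_coord[OF assms, of "v - m"] by simp
  then show "v \<in> (\<lambda>z. m + lincomb u w z) ` {z. P (maxnorm z)}"
    using * by (auto simp: gauge_at_def)
qed

text \<open>For \<open>v \<noteq> 0\<close>, the point where the ray from \<open>m\<close> in
  direction \<open>v\<close> meets the boundary of the parallelogram centred at
  \<open>m\<close>.\<close>

definition radial :: "complex \<Rightarrow> complex \<Rightarrow> complex \<Rightarrow> complex \<Rightarrow> complex" where
  "radial m u w v = m + v / of_real (gauge_at u w v)"

lemma radial_scale: "c > 0 \<Longrightarrow> radial m u w (of_real c * v) = radial m u w v"
  by (simp add: radial_def gauge_scale)

lemma cis_loop_free:
  assumes "0 \<le> s" "s \<le> 1" "0 \<le> t" "t \<le> 1" "cis (2 * pi * s) = cis (2 * pi * t)"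
  shows "s = t \<or> s = 0 \<and> t = 1 \<or> s = 1 \<and> t = 0"
proof -
  have "cis (2 * pi * s - 2 * pi * t) = 1"
    using assms(5) by (simp flip: cis_divide)
  then have "cos (2 * pi * s - 2 * pi * t) = 1" by (simp add: complex_eq_iff)
  then obtain n :: int where "2 * pi * s - 2 * pi * t = of_int n * 2 * pi"
    by (auto simp: cos_one_2pi_int)
  then have "2 * pi * (s - t) = 2 * pi * of_int n" by (simp add: algebra_simps)
  then have n: "s - t = of_int n" by simp
  then have "n = 0 \<or> n = 1 \<or> n = -1" using assms(1-4) by linarith
  then show ?thesis using n assms(1-4) by auto
qed

text \<open>As the domain is star-shaped about \<open>m\<close>, the quotient \<open>(\<gamma> t - z) / (\<gamma> t - m)\<close> avoids the
  nonpositive reals for \<open>z\<close> in the domain, so its argument is continuous and the winding around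
  \<open>z\<close> is the same as the one around \<open>m\<close>.\<close>

lemma pos_jordan_param_radial:
  fixes u w m e :: complex
  assumes E: "Im (cnj u * w) \<noteq> 0" and e: "e \<noteq> 0"
    and front: "frontier D = {v. gauge_at u w (v - m) = 1}"
    and D: "D = {v. gauge_at u w (v - m) < 1}"
  shows "pos_jordan_param D (\<lambda>t. radial m u w (e * cis (2 * pi * t)))"
proof -
  define h where "h t = e * cis (2 * pi * t)" for t
  define \<gamma> where "\<gamma> t = radial m u w (h t)" for t
  have h0: "h t \<noteq> 0" for t using e by (simp add: h_def)
  have g: "gauge_at u w (h t) > 0" for t by (rule gauge_pos[OF E h0])
  have cont: "continuous_on S \<gamma>" for S
    unfolding \<gamma>_def radial_def h_def using g[unfolded h_def]
    by (auto intro!: continuous_intros simp: cis_conv_exp less_imp_neq[symmetric])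
  have ends: "\<gamma> 1 = \<gamma> 0" by (simp add: \<gamma>_def h_def)
  have gm: "\<gamma> t - m = of_real (1 / gauge_at u w (h t)) * h t" for t
    by (simp add: \<gamma>_def radial_def)
  have g1: "gauge_at u w (\<gamma> t - m) = 1" for t
    unfolding gm gauge_scale using g[of t] by simp
  have "loop_free \<gamma>"
    unfolding loop_free_def
  proof (intro ballI impI)
    fix s t :: real
    assume st: "s \<in> {0..1}" "t \<in> {0..1}" "\<gamma> s = \<gamma> t"
    \<comment> \<open>All \<open>h t\<close> have modulus \<open>cmod e\<close>, so equal distances
      from \<open>m\<close> mean equal gauges, and then the directions agree.\<close>
    have "cmod (\<gamma> s - m) = cmod (\<gamma> t - m)" using st by simp
    then have "gauge_at u w (h s) = gauge_at u w (h t)"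
      using g[of s] g[of t] e unfolding gm by (simp add: norm_mult norm_divide h_def)
    moreover have "\<gamma> s - m = \<gamma> t - m" using st by simp
    ultimately have "cis (2 * pi * s) = cis (2 * pi * t)"
      using g[of t] e unfolding gm by (simp add: h_def)
    then show "s = t \<or> s = 0 \<and> t = 1 \<or> s = 1 \<and> t = 0"
      using cis_loop_free[of s t] st by auto
  qed
  moreover have "path_image \<gamma> = frontier D"
  proof
    show "path_image \<gamma> \<subseteq> frontier D" using g1 by (auto simp: path_image_def front)
    show "frontier D \<subseteq> path_image \<gamma>"
    proof
      fix v assume "v \<in> frontier D"
      then have v1: "gauge_at u w (v - m) = 1" by (simp add: front)
      then have v0: "v - m \<noteq> 0" using gauge_scale[of u w 0 0] by auto
      \<comment> \<open>The direction of \<open>v - m\<close> relative to \<open>e\<close>, as a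
        fraction of a full turn.\<close>
      define t where "t = Arg2pi ((v - m) / e) / (2 * pi)"
      define c where "c = cmod ((v - m) / e)"
      have c: "c > 0" using v0 e by (simp add: c_def)
      have t: "t \<in> {0..1}"
        using Arg2pi_ge_0[of "(v - m) / e"] Arg2pi_lt_2pi[of "(v - m) / e"] by (auto simp: t_def)
      have "(v - m) / e = of_real c * cis (2 * pi * t)"
        using Arg2pi_eq[of "(v - m) / e"] by (simp add: c_def t_def cis_conv_exp)
      then have "v - m = of_real c * h t" using e by (simp add: h_def field_simps)
      then have "radial m u w (v - m) = \<gamma> t"
        using radial_scale[OF c] by (simp add: \<gamma>_def)
      then have "\<gamma> t = v" using v1 by (simp add: radial_def)
      then show "v \<in> path_image \<gamma>" using t by (auto simp: path_image_def)
    qed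
  qed
  moreover have "winds_once \<gamma> z" if "z \<in> D" for z
    unfolding winds_once_def
  proof (intro exI conjI ballI)
    have z: "gauge_at u w (z - m) < 1" using that D by simp
    define q where "q t = 1 - (z - m) / (\<gamma> t - m)" for t
    \<comment> \<open>The first two summands form an argument of \<open>\<gamma> t - m\<close> and
      gain \<open>2 * pi\<close>; the last is that of the quotient and returns to its initial
      value.\<close>
    define \<theta> where "\<theta> t = Arg e + 2 * pi * t + Arg (q t)" for t
    have gm0: "\<gamma> t - m \<noteq> 0" for t using g1[of t] gauge_scale[of u w 0 0] by auto
    have q: "q t \<notin> \<real>\<^sub>\<le>\<^sub>0" for t
    proof
      assume "q t \<in> \<real>\<^sub>\<le>\<^sub>0"
      \<comment> \<open>A value \<open>k \<le> 0\<close> would give \<open>z - m\<close> the gauge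
        \<open>1 - k \<ge> 1\<close>, so \<open>z\<close> would not be in \<open>D\<close>.\<close>
      then obtain k where k: "q t = of_real k" "k \<le> 0" by (auto elim!: nonpos_Reals_cases)
      then have "(z - m) / (\<gamma> t - m) = of_real (1 - k)" by (simp add: q_def algebra_simps)
      then have "z - m = of_real (1 - k) * (\<gamma> t - m)" using gm0[of t] by (simp add: field_simps)
      then have "gauge_at u w (z - m) = \<bar>1 - k\<bar>" by (simp only: gauge_scale g1 mult_1_right)
      then show False using z k by simp
    qed
    have "continuous_on {0..1} q"
      unfolding q_def using gm0 by (auto intro!: continuous_intros cont)
    then show "continuous_on {0..1} \<theta>"
      unfolding \<theta>_def using q by (auto intro!: continuous_intros)
    show "\<theta> 1 - \<theta> 0 = 2 * pi" by (simp add: \<theta>_def q_def ends)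
    fix t :: real
    have "\<gamma> t - z = (\<gamma> t - m) * q t" using gm0[of t] by (simp add: q_def field_simps)
    also have "\<dots> = rcis (cmod (\<gamma> t - m)) (Arg e + 2 * pi * t) * rcis (cmod (q t)) (Arg (q t))"
    proof -
      have "h t = rcis (cmod e) (Arg e + 2 * pi * t)"
        using rcis_cmod_Arg[of e] unfolding h_def rcis_def cis_mult[symmetric] by (metis mult.assoc)
      then have "\<gamma> t - m = rcis (cmod (\<gamma> t - m)) (Arg e + 2 * pi * t)"
        unfolding gm using g[of t] by (simp add: rcis_def norm_mult norm_divide)
      then show ?thesis by (metis rcis_cmod_Arg)
    qed
    also have "\<dots> = rcis (cmod ((\<gamma> t - m) * q t)) (\<theta> t)"
      by (simp add: rcis_mult norm_mult \<theta>_def)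
    also have "(\<gamma> t - m) * q t = \<gamma> t - z" using gm0[of t] by (simp add: q_def field_simps)
    finally show "\<gamma> t - z = of_real (cmod (\<gamma> t - z)) * cis (\<theta> t)" by (simp add: rcis_def)
  qed
  ultimately have "pos_jordan_param D \<gamma>"
    unfolding pos_jordan_param_def simple_path_def path_def pathfinish_def pathstart_def
    using cont ends by auto
  moreover have "\<gamma> = (\<lambda>t. radial m u w (e * cis (2 * pi * t)))"
    by (simp add: fun_eq_iff \<gamma>_def h_def)
  ultimately show ?thesis by simp
qed

section \<open>The Ptolemy constant\<close>

text \<open>Makes the ratio blind to the exchanges left open by
  \<open>simple_path_order_periodic\<close>.\<close>

lemma ptol_swap: "ptol c b a d = ptol a b c d" "ptol a d c b = ptol a b c d"
  by (simp_all add: ptol_def norm_minus_commute add.commute mult.commute)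

lemma ptol_translate: "ptol (m + a) (m + b) (m + c) (m + d) = ptol a b c d"
  by (simp add: ptol_def)

text \<open>The length of the long diagonal divided by the smaller height.\<close>

definition aspect :: "complex \<Rightarrow> complex \<Rightarrow> real" where
  "aspect u w = max (cmod u) (cmod w) * sqrt ((cmod u)\<^sup>2 + (cmod w)\<^sup>2 + 2 * \<bar>Re (cnj u * w)\<bar>)
     / \<bar>Im (cnj u * w)\<bar>"

lemma aspect_swap: "aspect w u = aspect u w"
proof -
  have "\<bar>Re (cnj w * u)\<bar> = \<bar>Re (cnj u * w)\<bar>" "\<bar>Im (cnj w * u)\<bar> = \<bar>Im (cnj u * w)\<bar>"
    by (simp_all add: algebra_simps abs_minus_commute)
  then show ?thesis by (simp add: aspect_def max.commute add.commute)
qed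

text \<open>Write D for the absolute inner product, E for the determinant and M for the squared
  longer half-side. Lagrange's identity E^2 + D^2 = r^2 s^2 factors E^2 + (M + D)^2 as M (r^2 + s^2
  + 2 D).\<close>

lemma aspect_altdef:
  assumes "Im (cnj u * w) > 0"
  shows "sqrt ((Im (cnj u * w))\<^sup>2 + ((max (cmod u) (cmod w))\<^sup>2 + \<bar>Re (cnj u * w)\<bar>)\<^sup>2) / Im (cnj u * w) = aspect u w"
proof -
  let ?r = "cmod u" and ?s = "cmod w" and ?D = "\<bar>Re (cnj u * w)\<bar>" and ?E = "Im (cnj u * w)"
  have "?E\<^sup>2 + ?D\<^sup>2 = ?r\<^sup>2 * ?s\<^sup>2" using lagrange_identity[of u w] by simp
  then have "?E\<^sup>2 + ((max ?r ?s)\<^sup>2 + ?D)\<^sup>2 = (max ?r ?s)\<^sup>2 * (?r\<^sup>2 + ?s\<^sup>2 + 2 * ?D)"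
    by (auto simp: max_def power2_eq_square algebra_simps)
  then show ?thesis
    using assms by (simp add: aspect_def real_sqrt_mult max_def)
qed

lemma ptol_le_aspect:
  fixes p u w :: complex
  defines "G \<equiv> interior (convex hull {p, p + 2 * u, p + 2 * u + 2 * w, p + 2 * w})"
  assumes E: "Im (cnj u * w) \<noteq> 0" and \<gamma>: "pos_jordan_param G \<gamma>"
    and t: "0 \<le> t1" "t1 < t2" "t2 < t3" "t3 < t4" "t4 < 1"
    and dist: "distinct [\<gamma> t1, \<gamma> t2, \<gamma> t3, \<gamma> t4]"
  shows "ptol (\<gamma> t1) (\<gamma> t2) (\<gamma> t3) (\<gamma> t4) \<le> aspect u w"
proof -
  \<comment> \<open>With positive determinant \<open>sq\<close> traces the boundary
    counterclockwise; the other sign follows by exchanging the half-sides.\<close>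
  have *: "ptol (\<gamma> t1) (\<gamma> t2) (\<gamma> t3) (\<gamma> t4) \<le> aspect u w"
    if E: "Im (cnj u * w) > 0" and G: "G = interior (convex hull {p, p + 2 * u, p + 2 * u + 2 * w, p + 2 * w})"
    for u w
  proof -
    define m where "m = p + u + w"
    define f where "f t = m + lincomb u w (sq t)" for t
    have E': "Im (cnj u * w) \<noteq> 0" using E by simp
    have "frontier G = (\<lambda>z. m + lincomb u w z) ` range sq"
      unfolding G parallelogram_frontier[OF E'] range_sq m_def ..
    then have im: "path_image \<gamma> = range f"
      using \<gamma> by (simp add: pos_jordan_param_def image_image f_def)
    have "continuous_on UNIV f"
      unfolding f_def lincomb_def by (intro continuous_intros continuous_sq)
    moreover have "f (t + 4) = f t" for t by (simp add: f_def lincomb_sq_add_4)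
    ultimately obtain ta tb tc td where o: "ta < tb" "tb < tc" "tc < td" "td < ta + 4"
        and ac: "f ta = \<gamma> t1 \<and> f tc = \<gamma> t3 \<or> f ta = \<gamma> t3 \<and> f tc = \<gamma> t1"
        and bd: "f tb = \<gamma> t2 \<and> f td = \<gamma> t4 \<or> f tb = \<gamma> t4 \<and> f td = \<gamma> t2"
      using simple_path_order_periodic[OF _ t _ _ im dist] \<gamma> unfolding pos_jordan_param_def by metis
    let ?l = "\<lambda>t. lincomb u w (sq t)"
    have "distinct [f ta, f tb, f tc, f td]" using ac bd dist by auto
    then have d: "distinct [?l ta, ?l tb, ?l tc, ?l td]" by (simp add: f_def)
    have "ptol (\<gamma> t1) (\<gamma> t2) (\<gamma> t3) (\<gamma> t4) = ptol (f ta) (f tb) (f tc) (f td)"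
      using ac bd ptol_swap by metis
    also have "\<dots> = ptol (?l ta) (?l tb) (?l tc) (?l td)"
      unfolding f_def by (rule ptol_translate)
    also have "\<dots> \<le> aspect u w"
      unfolding aspect_altdef[OF E, symmetric]
      by (rule ptolemy_inequality_sq[OF E _ _ o refl refl refl refl d]) (auto simp: power_mono)
    finally show ?thesis .
  qed
  show ?thesis
  proof (cases "Im (cnj u * w) > 0")
    case True
    then show ?thesis using * G_def by blast
  next
    case False
    then have "Im (cnj w * u) > 0" using E by (simp add: algebra_simps)
    moreover have "G = interior (convex hull {p, p + 2 * w, p + 2 * w + 2 * u, p + 2 * u})"
      unfolding G_def by (simp add: insert_commute add.commute add.left_commute)
    ultimately show ?thesis using *[of w u] by (simp add: aspect_swap)
  qed
qed

section \<open>A quadruple that gives the lower bound\<close>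

text \<open>The points are the vertices of a parallelogram with diagonals \<open>2 * a\<close> and
  \<open>2 * b\<close>, so the parallelogram law evaluates the numerator.\<close>

lemma ptol_antipodal:
  assumes "a \<noteq> 0" "b \<noteq> 0"
  shows "ptol (m + a) (m + b) (m - a) (m - b) = (cmod a / cmod b + cmod b / cmod a) / 2"
proof -
  have 1: "cmod (m + a - (m + b)) = cmod (a - b)" "cmod (m - a - (m - b)) = cmod (a - b)"
    by (simp_all add: norm_minus_commute)
  have 2: "cmod (m + a - (m - b)) = cmod (a + b)" "cmod (m + b - (m - a)) = cmod (a + b)"
    by (simp_all add: add.commute)
  have "m + a - (m - a) = 2 * a" "m + b - (m - b) = 2 * b" by simp_all
  then have 3: "cmod (m + a - (m - a)) = 2 * cmod a" "cmod (m + b - (m - b)) = 2 * cmod b"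
    by (simp_all add: norm_mult)
  have "cmod (a - b) * cmod (a - b) + cmod (a + b) * cmod (a + b) = 2 * (cmod a)\<^sup>2 + 2 * (cmod b)\<^sup>2"
    unfolding power2_eq_square[symmetric] cmod_power2 by (simp add: power2_eq_square algebra_simps)
  then show ?thesis
    unfolding ptol_def 1 2 3 using assms by (simp add: field_simps power2_eq_square)
qed

text \<open>The radial loop that starts at \<open>m + a\<close> meets \<open>m + b\<close> within
  half a turn because \<open>Im (cnj a * b) > 0\<close>. By symmetry of the gauge the antipodes
  follow exactly half a turn later.\<close>

lemma antipodal_in_order:
  fixes u w m a b :: complex
  assumes E: "Im (cnj u * w) \<noteq> 0"
    and front: "frontier D = {v. gauge_at u w (v - m) = 1}"
    and D: "D = {v. gauge_at u w (v - m) < 1}"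
    and a: "gauge_at u w a = 1" and b: "gauge_at u w b = 1" and pos: "Im (cnj a * b) > 0"
  shows "\<exists>\<gamma> t1 t2 t3 t4. pos_jordan_param D \<gamma> \<and> 0 \<le> t1 \<and> t1 < t2 \<and> t2 < t3 \<and> t3 < t4 \<and> t4 < 1 \<and>
    \<gamma> t1 = m + a \<and> \<gamma> t2 = m + b \<and> \<gamma> t3 = m - a \<and> \<gamma> t4 = m - b"
proof -
  have a0: "a \<noteq> 0" and b0: "b \<noteq> 0" using pos by auto
  define \<gamma> where "\<gamma> t = radial m u w (a * cis (2 * pi * t))" for t
  define t where "t = Arg (b / a) / (2 * pi)"
  define c where "c = cmod (b / a)"
  have c: "c > 0" using a0 b0 by (simp add: c_def)
  have "b / a = (cnj a * b) / of_real ((cmod a)\<^sup>2)"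
    by (subst complex_div_cnj) (simp add: mult.commute)
  then have "Im (b / a) > 0" using pos a0 by (simp only: Im_divide_of_real) simp
  then have "0 < Arg (b / a)" "Arg (b / a) < pi" using iffD2[OF Arg_lt_pi, of "b / a"] by auto
  then have t: "0 < t" "t < 1 / 2" by (auto simp: t_def field_simps)
  have "b / a = of_real c * cis (2 * pi * t)"
    using rcis_cmod_Arg[of "b / a"] by (simp add: rcis_def c_def t_def)
  then have bt: "b = of_real c * (a * cis (2 * pi * t))" using a0 by (simp add: field_simps)
  have half: "cis (2 * pi * (s + 1 / 2)) = - cis (2 * pi * s)" for s
    by (simp add: ring_distribs flip: cis_mult)
  have g0: "\<gamma> 0 = m + a" by (simp add: \<gamma>_def radial_def a)
  have gt: "\<gamma> t = m + b"
    unfolding \<gamma>_def using radial_scale[OF c, of m u w "a * cis (2 * pi * t)"] unfolding bt[symmetric]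
    by (simp add: radial_def b)
  have gh: "\<gamma> (s + 1 / 2) = 2 * m - \<gamma> s" for s
    unfolding \<gamma>_def half by (simp add: radial_def gauge_minus)
  have "pos_jordan_param D \<gamma>"
    unfolding \<gamma>_def by (rule pos_jordan_param_radial[OF E a0 front D])
  moreover have "\<gamma> (1 / 2) = m - a" "\<gamma> (t + 1 / 2) = m - b" using gh[of 0] gh[of t] g0 gt by auto
  ultimately show ?thesis
    using t g0 gt by (intro exI[of _ \<gamma>] exI[of _ 0] exI[of _ t] exI[of _ "1 / 2"] exI[of _ "t + 1 / 2"]) auto
qed

lemma aspect_attained:
  fixes p u w :: complex
  defines "G \<equiv> interior (convex hull {p, p + 2 * u, p + 2 * u + 2 * w, p + 2 * w})"
  assumes E: "Im (cnj u * w) \<noteq> 0"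
  shows "\<exists>a b c d. (aspect u w + 1 / aspect u w) / 2 = ptol a b c d \<and> distinct [a, b, c, d] \<and>
    (\<exists>\<gamma> t1 t2 t3 t4. pos_jordan_param G \<gamma> \<and> 0 \<le> t1 \<and> t1 < t2 \<and> t2 < t3 \<and> t3 < t4 \<and> t4 < 1 \<and>
      \<gamma> t1 = a \<and> \<gamma> t2 = b \<and> \<gamma> t3 = c \<and> \<gamma> t4 = d)"
proof -
  \<comment> \<open>Here \<open>u'\<close> is the longer half-side; the remaining case exchanges the
    two.\<close>
  have *: ?thesis
    if E: "Im (cnj u' * w') \<noteq> 0" and G: "G = interior (convex hull {p, p + 2 * u', p + 2 * u' + 2 * w', p + 2 * w'})"
      and le: "cmod w' \<le> cmod u'" and asp: "aspect u w = aspect u' w'"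
    for u' w'
  proof -
    define m where "m = p + u' + w'"
    define dt where "dt = Re (cnj u' * w')"
    \<comment> \<open>The sign selects the longer diagonal.\<close>
    define \<sigma> :: real where "\<sigma> = (if dt \<ge> 0 then 1 else -1)"
    \<comment> \<open>Chosen so that \<open>b\<close> is orthogonal to \<open>u'\<close>:
      \<open>b\<close> points from the centre to the foot of the perpendicular on a longer
      side.\<close>
    define x where "x = - dt / (cmod u')\<^sup>2"
    define a where "a = lincomb u' w' (Complex 1 \<sigma>)"
    define b where "b = lincomb u' w' (Complex x 1)"
    have u0: "u' \<noteq> 0" using E by auto
    have r0: "cmod u' > 0" using u0 by simp
    \<comment> \<open>Since \<open>u'\<close> is the longer half-side, the inner product is smaller
      than its square, so the foot lies strictly inside the side.\<close>
    have "(Im (cnj u' * w'))\<^sup>2 > 0" using E by simp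
    moreover have lag: "(Im (cnj u' * w'))\<^sup>2 + dt\<^sup>2 = (cmod u')\<^sup>2 * (cmod w')\<^sup>2"
      unfolding dt_def by (rule lagrange_identity)
    moreover have "(cmod u')\<^sup>2 * (cmod w')\<^sup>2 \<le> (cmod u')\<^sup>2 * (cmod u')\<^sup>2"
      using le by (intro mult_left_mono power_mono) auto
    ultimately have "dt\<^sup>2 < ((cmod u')\<^sup>2)\<^sup>2" unfolding power2_eq_square[of "(cmod u')\<^sup>2"] by linarith
    then have "\<bar>dt\<bar> < (cmod u')\<^sup>2" using power2_less_imp_less[of "\<bar>dt\<bar>" "(cmod u')\<^sup>2"] by simp
    then have x: "\<bar>x\<bar> < 1" using r0 by (simp add: x_def)
    have ga: "gauge_at u' w' a = 1" and gb: "gauge_at u' w' b = 1"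
      using x by (auto simp: a_def b_def gauge_at_def coord_lincomb[OF E] maxnorm_def \<sigma>_def)
    have "Im (cnj a * b) = Im (cnj u' * w') * (1 - \<sigma> * x)"
      by (simp add: a_def b_def lincomb_def algebra_simps)
    moreover have "1 - \<sigma> * x > 0" using x by (auto simp: \<sigma>_def)
    ultimately have ab: "Im (cnj a * b) \<noteq> 0" using E by simp
    then have a0: "a \<noteq> 0" and b0: "b \<noteq> 0" by auto
    have "(cmod a)\<^sup>2 = (cmod u')\<^sup>2 + \<sigma>\<^sup>2 * (cmod w')\<^sup>2 + 2 * (\<sigma> * dt)"
      unfolding cmod_power2 a_def dt_def by (simp add: lincomb_def power2_eq_square algebra_simps)
    then have "(cmod a)\<^sup>2 = (cmod u')\<^sup>2 + (cmod w')\<^sup>2 + 2 * \<bar>dt\<bar>" by (auto simp: \<sigma>_def)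
    then have ca: "cmod a = sqrt ((cmod u')\<^sup>2 + (cmod w')\<^sup>2 + 2 * \<bar>dt\<bar>)"
      by (metis norm_ge_zero real_sqrt_unique)
    have "(cmod b)\<^sup>2 = x\<^sup>2 * (cmod u')\<^sup>2 + (cmod w')\<^sup>2 + 2 * (x * dt)"
      unfolding cmod_power2 b_def dt_def by (simp add: lincomb_def power2_eq_square algebra_simps)
    also have "\<dots> * (cmod u')\<^sup>2 = (cmod u')\<^sup>2 * (cmod w')\<^sup>2 - dt\<^sup>2"
      using r0 by (simp add: x_def field_simps power2_eq_square)
    finally have "(cmod b * cmod u')\<^sup>2 = (Im (cnj u' * w'))\<^sup>2"
      using lag by (simp add: power_mult_distrib)
    \<comment> \<open>Height times base is the area spanned by the half-sides.\<close>
    then have cb: "cmod b * cmod u' = \<bar>Im (cnj u' * w')\<bar>"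
      using power2_eq_imp_eq[of "cmod b * cmod u'" "\<bar>Im (cnj u' * w')\<bar>"] by simp
    have "aspect u' w' = cmod u' * cmod a / (cmod b * cmod u')"
      unfolding aspect_def cb dt_def[symmetric] ca[symmetric] max_absorb1[OF le] ..
    then have asp2: "aspect u w = cmod a / cmod b"
      using asp r0 by simp
    have G1: "G = {v. gauge_at u' w' (v - m) < 1}"
      unfolding G parallelogram_interior[OF E] m_def[symmetric]
      using gauge_image_iff[OF E, of _ m "\<lambda>y. y < 1"] by blast
    have G2: "frontier G = {v. gauge_at u' w' (v - m) = 1}"
      unfolding G parallelogram_frontier[OF E] m_def[symmetric]
      using gauge_image_iff[OF E, of _ m "\<lambda>y. y = 1"] by blast
    \<comment> \<open>Of \<open>b\<close> and \<open>- b\<close>, which have the same modulus, the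
      one counterclockwise from \<open>a\<close> will be used.\<close>
    have fin: ?thesis if "gauge_at u' w' b' = 1" "Im (cnj a * b') > 0" "cmod b' = cmod b" for b'
    proof -
      have b'0: "b' \<noteq> 0" and ne: "a \<noteq> b'" "a \<noteq> - b'" using that(2) by (auto simp: algebra_simps)
      have dist: "distinct [m + a, m + b', m - a, m - b']"
        using a0 b'0 ne by (auto simp: complex_eq_iff)
      have "(aspect u w + 1 / aspect u w) / 2 = ptol (m + a) (m + b') (m - a) (m - b')"
        using ptol_antipodal[OF a0 b'0, of m] that(3) by (simp add: asp2)
      then show ?thesis
        using dist antipodal_in_order[OF E G2 G1 ga that(1,2)] by metis
    qed
    show ?thesis
    proof (cases "Im (cnj a * b) > 0")
      case True
      then show ?thesis using fin[of b] gb by simp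
    next
      case False
      then show ?thesis using fin[of "- b"] gb ab by (simp add: gauge_minus)
    qed
  qed
  show ?thesis
  proof (cases "cmod w \<le> cmod u")
    case True
    then show ?thesis using *[of u w] E G_def by blast
  next
    case False
    have "Im (cnj w * u) \<noteq> 0" using E by (simp add: algebra_simps)
    moreover have "G = interior (convex hull {p, p + 2 * w, p + 2 * w + 2 * u, p + 2 * u})"
      unfolding G_def by (simp add: insert_commute add.commute add.left_commute)
    ultimately show ?thesis using *[of w u] False by (simp add: aspect_swap)
  qed
qed

text \<open>Numerator and denominator are both homogeneous of degree 2; with
  \<open>c = 1 / 2\<close> this passes from sides to half-sides.\<close>

lemma aspect_scale:
  assumes "c > 0"
  shows "aspect (of_real c * u) (of_real c * w) = aspect u w"
proof -
  have "Re (cnj (of_real c * u) * (of_real c * w)) = c\<^sup>2 * Re (cnj u * w)"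
    "Im (cnj (of_real c * u) * (of_real c * w)) = c\<^sup>2 * Im (cnj u * w)"
    by (simp_all add: power2_eq_square algebra_simps)
  moreover have "cmod (of_real c * v) = c * cmod v" for v
    using assms by (simp add: norm_mult)
  moreover have "(c * cmod u)\<^sup>2 + (c * cmod w)\<^sup>2 + 2 * \<bar>c\<^sup>2 * Re (cnj u * w)\<bar> =
      c\<^sup>2 * ((cmod u)\<^sup>2 + (cmod w)\<^sup>2 + 2 * \<bar>Re (cnj u * w)\<bar>)"
    by (simp only: abs_mult abs_power2 power_mult_distrib) (simp only: algebra_simps)
  moreover have "max (c * cmod u) (c * cmod w) = c * max (cmod u) (cmod w)"
    using assms by (simp add: max_mult_distrib_left)
  ultimately show ?thesis
    using assms unfolding aspect_def
    by (simp only: real_sqrt_mult real_sqrt_abs abs_mult abs_power2) (simp add: power2_eq_square)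
qed

text \<open>The spanned area is r s sin \<alpha> = max(r, s) min(r, s) sin \<alpha>, so the maximum
  cancels. Taking the smaller of two supplementary angles keeps the sine and replaces the cosine by
  its absolute value.\<close>

lemma aspect_eq_angle:
  assumes indep: "Im (cnj u * w) \<noteq> 0"
    and \<alpha>: "\<alpha> = min (vec_angle u w) (pi - vec_angle u w)"
  shows "sqrt ((cmod u)\<^sup>2 + 2 * cmod u * cmod w * cos \<alpha> + (cmod w)\<^sup>2) / (min (cmod u) (cmod w) * sin \<alpha>) = aspect u w"
proof -
  let ?r = "cmod u" and ?s = "cmod w" and ?E = "Im (cnj u * w)" and ?d = "Re (cnj u * w)"
  have rs: "?r > 0" "?s > 0" using indep by auto
  have lag: "?E\<^sup>2 + ?d\<^sup>2 = (?r * ?s)\<^sup>2" using lagrange_identity[of u w] by (simp add: power_mult_distrib)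
  define y where "y = ?d / (?r * ?s)"
  have y2: "1 - y\<^sup>2 = (?E / (?r * ?s))\<^sup>2"
    using rs lag by (simp add: y_def power_divide field_simps)
  then have "y\<^sup>2 \<le> 1" by (metis diff_ge_0_iff_ge zero_le_power2)
  then have y1: "\<bar>y\<bar> \<le> 1" by (simp add: abs_square_le_1)
  have va: "vec_angle u w = arccos y" by (simp add: vec_angle_def y_def)
  have c: "cos (arccos y) = y" "0 \<le> arccos y" "arccos y \<le> pi"
    using y1 by (auto simp: cos_arccos arccos_lbound arccos_ubound)
  have s: "sin (arccos y) = \<bar>?E\<bar> / (?r * ?s)"
    using y1 rs y2 by (simp add: sin_arccos_abs abs_mult)
  have "sin \<alpha> = \<bar>?E\<bar> / (?r * ?s)"
    unfolding \<alpha> va min_def by (simp add: s)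
  then have "\<bar>?E\<bar> = ?r * ?s * sin \<alpha>" using rs by simp
  also have "?r * ?s = max ?r ?s * min ?r ?s" by (simp add: min_def max_def)
  finally have "\<bar>?E\<bar> = max ?r ?s * (min ?r ?s * sin \<alpha>)" by (simp only: mult.assoc)
  moreover have "cos \<alpha> = \<bar>y\<bar>"
  proof (cases "arccos y \<le> pi / 2")
    case True
    then have "cos (arccos y) \<ge> 0" using c by (intro cos_ge_zero) auto
    then show ?thesis using True c unfolding \<alpha> va min_def by simp
  next
    case False
    then have "cos (pi - arccos y) \<ge> 0" using c by (intro cos_ge_zero) auto
    then show ?thesis using False c unfolding \<alpha> va min_def by simp
  qed
  then have "?r * ?s * cos \<alpha> = \<bar>?d\<bar>"
    using rs by (simp add: y_def abs_mult)
  then have "?r\<^sup>2 + 2 * ?r * ?s * cos \<alpha> + ?s\<^sup>2 = ?r\<^sup>2 + ?s\<^sup>2 + 2 * \<bar>?d\<bar>"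
    by linarith
  moreover have "max ?r ?s \<noteq> 0" using rs by (auto simp: max_def)
  ultimately show ?thesis
    unfolding aspect_def by (simp only: nonzero_mult_divide_mult_cancel_left not_False_eq_True)
qed

theorem theorem1p5:
  fixes p u w :: complex and r s \<alpha> A :: real
  assumes indep: "Im (cnj u * w) \<noteq> 0"
    and r: "r = cmod u" and s: "s = cmod w"
    and \<alpha>: "\<alpha> = min (vec_angle u w) (pi - vec_angle u w)"
    and A: "A = sqrt (r^2 + 2 * r * s * cos \<alpha> + s^2) / (min r s * sin \<alpha>)"
  shows "(A + 1 / A) / 2 \<le> ptolemy_const (interior (convex hull {p, p + u, p + u + w, p + w}))
       \<and> ptolemy_const (interior (convex hull {p, p + u, p + u + w, p + w})) \<le> A"
proof -
  define G where "G = interior (convex hull {p, p + u, p + u + w, p + w})"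
  define S where "S = {ptol a b c d | a b c d.
     distinct [a, b, c, d] \<and>
     (\<exists>\<gamma> t1 t2 t3 t4. pos_jordan_param G \<gamma> \<and> 0 \<le> t1 \<and> t1 < t2 \<and> t2 < t3 \<and> t3 < t4 \<and> t4 < 1 \<and>
        \<gamma> t1 = a \<and> \<gamma> t2 = b \<and> \<gamma> t3 = c \<and> \<gamma> t4 = d)}"
  have G2: "G = interior (convex hull {p, p + 2 * (u / 2), p + 2 * (u / 2) + 2 * (w / 2), p + 2 * (w / 2)})"
    by (simp add: G_def)
  have E: "Im (cnj (u / 2) * (w / 2)) \<noteq> 0"
    using indep by simp
  have asp: "aspect (u / 2) (w / 2) = A"
    using aspect_eq_angle[OF indep \<alpha>] aspect_scale[of "1 / 2" u w] by (simp add: A r s)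
  have mem: "(A + 1 / A) / 2 \<in> S"
    using aspect_attained[OF E, of p] unfolding G2[symmetric] asp S_def by blast
  have le: "x \<le> A" if "x \<in> S" for x
    using that ptol_le_aspect[OF E, of p] unfolding G2[symmetric] asp S_def by blast
  \<comment> \<open>\<open>Sup\<close> on the reals is meaningful for nonempty bounded sets:
    \<open>mem\<close> gives nonemptiness and \<open>le\<close> the bound.\<close>
  have "(A + 1 / A) / 2 \<le> Sup S"
    by (rule cSup_upper[OF mem bdd_aboveI[OF le]])
  moreover have "Sup S \<le> A"
    using mem by (intro cSup_least le) auto
  ultimately show ?thesis by (simp add: ptolemy_const_def S_def G_def)
qed

end
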